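(* The ternary oriented Jones subgroup $\vec F_3\le F_3$ is isomorphic to the Higman--Thompson group $F_4$.
   Context: For $n\ge2$, let $X_n=\{0,\dots,n-1\}$ and let $\mathcal C_n=X_n^{\mathbb N}$. $F_n$ is the group of all homeomorphisms $f$ of $\mathcal C_n$ for which there are finite complete prefix codes $\{u_1<\dots<u_k\}$ and $\{v_1<\dots<v_k\}$ of finite words over $X_n$ (listed in lexicographic order; complete means that the cylinders $u_i\mathcal C_n$ partition $\mathcal C_n$) such that $f(u_i\omega)=v_i\omega$ for all $i$ and all $\omega\in\mathcal C_n$. Such a pair of codes is called a tree diagram of $f$ with branch pairs $u_i\to v_i$. Equivalently, $F_n$ is the group of increasing piecewise-linear homeomorphisms of $[0,1]$ with breakpoints in $\mathbb Z[1/n]$ and slopes integer powers of $n$. The subgroup $\vec F_3\le F_3$ (Jones' ternary oriented subgroup) has the following description. Consider the deterministic automaton over $\{0,1,2\}$ with states $\eta_{00},\eta_{01},\eta_{10},\eta_{11}$, initial state $\eta_{00}$, and transitions (listing the successors under the letters $0,1,2$): $\eta_{00}\mapsto(\eta_{00},\eta_{11},\eta_{01})$; $\eta_{01}\mapsto(\eta_{01},\eta_{10},\eta_{00})$; $\eta_{10}\mapsto(\eta_{11},\eta_{01},\eta_{10})$; $\eta_{11}\mapsto(\eta_{10},\eta_{00},\eta_{11})$. Then $\vec F_3$ is the set of all $f\in F_3$ admitting a tree diagram with branch pairs $u_i\to v_i$ such that, for every $i$, reading $u_i$ and reading $v_i$ from the initial state ends at the same state. *)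

theory Defs
  imports
    "HOL-Analysis.Function_Topology"
    "HOL-Algebra.Bij"
    "HOL-Library.Omega_Words_Fun"
    "HOL-Library.Sublist"
begin

text \<open>Infinite words are functions on \<open>nat\<close>; the letters of $X_n$ are the naturals below \<open>n\<close>.\<close>

definition cantor_top :: "nat \<Rightarrow> (nat \<Rightarrow> nat) topology" where
  "cantor_top n = product_topology (\<lambda>_. discrete_topology {..<n}) UNIV"

abbreviation cantor :: "nat \<Rightarrow> (nat \<Rightarrow> nat) set" where
  "cantor n \<equiv> topspace (cantor_top n)"

lemma cantor_eq: "cantor n = {\<omega>. \<forall>i. \<omega> i < n}"
  by (auto simp: cantor_top_def PiE_UNIV_domain)

definition cylinder :: "nat \<Rightarrow> nat list \<Rightarrow> (nat \<Rightarrow> nat) set" where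
  "cylinder n u = (\<lambda>\<omega>. u \<frown> \<omega>) ` cantor n"

definition prefix_code :: "nat \<Rightarrow> nat list set \<Rightarrow> bool" where
  "prefix_code n U \<longleftrightarrow> finite U \<and> U \<subseteq> lists {..<n} \<and> (\<forall>u\<in>U. \<forall>v\<in>U. prefix u v \<longrightarrow> u = v)"

definition complete_prefix_code :: "nat \<Rightarrow> nat list set \<Rightarrow> bool" where
  "complete_prefix_code n U \<longleftrightarrow> prefix_code n U \<and>
     disjoint_family_on (cylinder n) U \<and> (\<Union>u\<in>U. cylinder n u) = cantor n"

text \<open>A code $\{u_1 < \dots < u_k\}$ is represented by its lexicographically increasing list.\<close>

definition lex_sorted :: "nat list list \<Rightarrow> bool" where
  "lex_sorted us \<longleftrightarrow> sorted_wrt (\<lambda>u v. (u, v) \<in> lexord {(a, b). a < b}) us"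

definition tree_diagram ::
  "nat \<Rightarrow> ((nat \<Rightarrow> nat) \<Rightarrow> (nat \<Rightarrow> nat)) \<Rightarrow> nat list list \<Rightarrow> nat list list \<Rightarrow> bool" where
  "tree_diagram n f us vs \<longleftrightarrow>
     complete_prefix_code n (set us) \<and> lex_sorted us \<and>
     complete_prefix_code n (set vs) \<and> lex_sorted vs \<and>
     length us = length vs \<and>
     (\<forall>i<length us. \<forall>\<omega>\<in>cantor n. f (us ! i \<frown> \<omega>) = vs ! i \<frown> \<omega>)"

text \<open>
  Homeomorphisms are taken in \<open>Bij\<close>, i.e. with the value \<open>undefined\<close> off the Cantor space, so
  that they form a group under composition. The definition is meant for \<open>n \<ge> 2\<close>.
\<close>

definition F_carrier :: "nat \<Rightarrow> ((nat \<Rightarrow> nat) \<Rightarrow> (nat \<Rightarrow> nat)) set" where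
  "F_carrier n = {f \<in> Bij (cantor n). homeomorphic_map (cantor_top n) (cantor_top n) f \<and>
     (\<exists>us vs. tree_diagram n f us vs)}"

definition F_group :: "nat \<Rightarrow> ((nat \<Rightarrow> nat) \<Rightarrow> (nat \<Rightarrow> nat)) monoid" where
  "F_group n = BijGroup (cantor n) \<lparr>carrier := F_carrier n\<rparr>"

datatype jones_state = Eta00 | Eta01 | Eta10 | Eta11

text \<open>Only the letters 0, 1, 2 occur below; the value at other letters is irrelevant.\<close>

primrec jones_step :: "jones_state \<Rightarrow> nat \<Rightarrow> jones_state" where
  "jones_step Eta00 x = [Eta00, Eta11, Eta01] ! x"
| "jones_step Eta01 x = [Eta01, Eta10, Eta00] ! x"
| "jones_step Eta10 x = [Eta11, Eta01, Eta10] ! x"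
| "jones_step Eta11 x = [Eta10, Eta00, Eta11] ! x"

definition jones_read :: "nat list \<Rightarrow> jones_state" where
  "jones_read u = foldl jones_step Eta00 u"

definition jones_F3 :: "((nat \<Rightarrow> nat) \<Rightarrow> (nat \<Rightarrow> nat)) set" where
  "jones_F3 = {f \<in> F_carrier 3. \<exists>us vs. tree_diagram 3 f us vs \<and>
     (\<forall>i<length us. jones_read (us ! i) = jones_read (vs ! i))}"

end

theory Submission
  imports Defs "HOL-Analysis.T1_Spaces"
begin

text \<open>
  A quaternary word is translated letter by letter into a ternary word by a transducer whose states
  are those of the Jones automaton: after reading \<open>w\<close> it is in the state that the automaton reaches
  on the output. This induces an order-preserving bijection from the quaternary to the ternary
  Cantor space, and also a surjection on finite words. Conjugation by it identifies the two groups: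
  if a ternary branch \<open>u \<rightarrow> v\<close> preserves the state, then \<open>u\<close> and \<open>v\<close> are, after a common extension,
  outputs of words \<open>w\<close> and \<open>w'\<close> leading to the same state, and the conjugate acts by \<open>w \<rightarrow> w'\<close>.
  Conversely the \<open>i\<close>-th leaf of a quaternary tree has digit sum \<open>i\<close> modulo 3, so corresponding
  leaves have the same digit sum; this determines the state of the transducer except
  that \<open>Eta01\<close> and \<open>Eta10\<close> share the class 2. Their translations differ only by
  a shift of the first letter, after which the states agree.
\<close>

section \<open>Locally prefix-replacing, order-preserving bijections\<close>

definition wless :: "(nat \<Rightarrow> nat) \<Rightarrow> (nat \<Rightarrow> nat) \<Rightarrow> bool" where
  "wless \<alpha> \<beta> \<longleftrightarrow> (\<exists>k. (\<forall>i<k. \<alpha> i = \<beta> i) \<and> \<alpha> k < \<beta> k)"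

lemma wless_irrefl [simp]: "\<not> wless \<alpha> \<alpha>"
  by (auto simp: wless_def)

lemma wless_asym: "wless \<alpha> \<beta> \<Longrightarrow> \<not> wless \<beta> \<alpha>"
  unfolding wless_def by (metis linorder_neqE_nat order_less_asym order_less_irrefl)

lemma wless_linear: "wless \<alpha> \<beta> \<or> \<alpha> = \<beta> \<or> wless \<beta> \<alpha>"
proof (cases "\<alpha> = \<beta>")
  case False
  define k where "k = (LEAST k. \<alpha> k \<noteq> \<beta> k)"
  from False have "\<exists>k. \<alpha> k \<noteq> \<beta> k" by auto
  then have "\<alpha> k \<noteq> \<beta> k" unfolding k_def by (rule LeastI_ex)
  moreover have "\<forall>i<k. \<alpha> i = \<beta> i" unfolding k_def using not_less_Least by blast
  ultimately show ?thesis unfolding wless_def by (metis linorder_neqE_nat)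
qed simp

lemma wless_build: "wless (a ## \<alpha>) (b ## \<beta>) \<longleftrightarrow> a < b \<or> a = b \<and> wless \<alpha> \<beta>"
proof
  assume "wless (a ## \<alpha>) (b ## \<beta>)"
  then obtain k where k: "\<forall>i<k. (a ## \<alpha>) i = (b ## \<beta>) i" "(a ## \<alpha>) k < (b ## \<beta>) k"
    by (auto simp: wless_def)
  show "a < b \<or> a = b \<and> wless \<alpha> \<beta>"
  proof (cases k)
    case 0
    then show ?thesis using k(2) by simp
  next
    case (Suc j)
    then have "a = b" using k(1)[rule_format, of 0] by simp
    moreover have "\<forall>i<j. \<alpha> i = \<beta> i"
      using k(1)[rule_format, of "Suc i" for i] Suc by auto
    ultimately show ?thesis using k(2) Suc by (auto simp: wless_def)
  qed
next
  assume "a < b \<or> a = b \<and> wless \<alpha> \<beta>"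
  then show "wless (a ## \<alpha>) (b ## \<beta>)"
  proof (elim disjE conjE)
    assume "a < b"
    then show ?thesis unfolding wless_def by (intro exI[of _ 0]) simp
  next
    assume "a = b" "wless \<alpha> \<beta>"
    then obtain k where "\<forall>i<k. \<alpha> i = \<beta> i" "\<alpha> k < \<beta> k" by (auto simp: wless_def)
    with \<open>a = b\<close> show ?thesis
      unfolding wless_def by (intro exI[of _ "Suc k"]) (auto simp: less_Suc_eq_0_disj)
  qed
qed

lemma wless_conc [simp]: "wless (u \<frown> \<alpha>) (u \<frown> \<beta>) \<longleftrightarrow> wless \<alpha> \<beta>"
  by (induction u) (auto simp: wless_build)

text \<open>\<open>lexord\<close> also puts a word before its proper extensions. Without that case
  the first difference lies inside both words, so the tails cannot affect the comparison.\<close>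

lemma lexord_imp_wless:
  "(u, v) \<in> lexord {(a, b). a < b} \<Longrightarrow> \<not> Sublist.prefix u v \<Longrightarrow> wless (u \<frown> \<alpha>) (v \<frown> \<beta>)"
proof (induction u arbitrary: v)
  case (Cons a u)
  then show ?case by (cases v) (auto simp: wless_build)
qed simp

lemma wless_imp_lexord:
  "wless (u \<frown> \<alpha>) (v \<frown> \<beta>) \<Longrightarrow> \<not> Sublist.prefix u v \<Longrightarrow> \<not> Sublist.prefix v u
    \<Longrightarrow> (u, v) \<in> lexord {(a, b). a < b}"
proof (induction u arbitrary: v)
  case (Cons a u)
  then show ?case by (cases v) (auto simp: wless_build)
qed simp

lemma conc_eq_imp_prefix:
  "u \<frown> \<alpha> = v \<frown> \<beta> \<Longrightarrow> Sublist.prefix u v \<or> Sublist.prefix v u"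
proof (induction u arbitrary: v)
  case (Cons a u)
  then show ?case by (cases v) auto
qed simp

lemma all_nat_Suc_conv: "(\<forall>i. P i) \<longleftrightarrow> P 0 \<and> (\<forall>i. P (Suc i))"
  by (metis not0_implies_Suc)

lemma conc_in_cantor [simp]:
  "u \<frown> \<alpha> \<in> cantor n \<longleftrightarrow> u \<in> lists {..<n} \<and> \<alpha> \<in> cantor n"
proof (induction u)
  case (Cons a u)
  have "a ## \<beta> \<in> cantor n \<longleftrightarrow> a < n \<and> \<beta> \<in> cantor n" for \<beta>
    unfolding cantor_eq mem_Collect_eq by (subst all_nat_Suc_conv) simp
  with Cons show ?case by auto
qed simp

lemma suffix_in_cantor [simp]: "\<omega> \<in> cantor n \<Longrightarrow> Omega_Words_Fun.suffix k \<omega> \<in> cantor n"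
  by (auto simp: cantor_eq)

lemma subsequence_in_lists [simp]: "\<omega> \<in> cantor n \<Longrightarrow> \<omega> [i \<rightarrow> j] \<in> lists {..<n}"
  by (auto simp: cantor_eq)

lemma cantor_nonempty: "0 < n \<Longrightarrow> (\<lambda>_. 0) \<in> cantor n"
  by (simp add: cantor_eq)

lemma Bij_in_cantor: "f \<in> Bij (cantor n) \<Longrightarrow> \<omega> \<in> cantor n \<Longrightarrow> f \<omega> \<in> cantor n"
  by (auto dest: Bij_imp_funcset)

lemma Bij_inv_left: "f \<in> Bij S \<Longrightarrow> x \<in> S \<Longrightarrow> inv_into S f (f x) = x"
  by (auto simp: Bij_def bij_betw_def)

lemma Bij_inv_right: "f \<in> Bij S \<Longrightarrow> x \<in> S \<Longrightarrow> f (inv_into S f x) = x"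
  by (auto simp: Bij_def bij_betw_def f_inv_into_f)

lemma Bij_injD: "f \<in> Bij S \<Longrightarrow> f x = f y \<Longrightarrow> x \<in> S \<Longrightarrow> y \<in> S \<Longrightarrow> x = y"
  by (auto simp: Bij_def bij_betw_def dest: inj_onD)

section \<open>Groups of increasing, locally prefix-replacing bijections\<close>

definition word_increasing :: "(nat \<Rightarrow> nat) set \<Rightarrow> ((nat \<Rightarrow> nat) \<Rightarrow> (nat \<Rightarrow> nat)) \<Rightarrow> bool" where
  "word_increasing S f \<longleftrightarrow> (\<forall>\<alpha>\<in>S. \<forall>\<beta>\<in>S. wless \<alpha> \<beta> \<longrightarrow> wless (f \<alpha>) (f \<beta>))"

definition branch ::
  "(nat list \<Rightarrow> 'q) \<Rightarrow> nat \<Rightarrow> ((nat \<Rightarrow> nat) \<Rightarrow> (nat \<Rightarrow> nat)) \<Rightarrow> nat list \<Rightarrow> nat list \<Rightarrow> bool" where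
  "branch q n f u v \<longleftrightarrow> u \<in> lists {..<n} \<and> v \<in> lists {..<n} \<and> q u = q v \<and>
     (\<forall>\<tau>\<in>cantor n. f (u \<frown> \<tau>) = v \<frown> \<tau>)"

text \<open>A pointwise substitute for a tree diagram: one branch through each point, with no finite
  code and no sorting. It passes to inverses, composites and conjugates without refining trees;
  compactness and monotonicity give the tree diagram back.\<close>

definition locally_branching ::
  "(nat list \<Rightarrow> 'q) \<Rightarrow> nat \<Rightarrow> ((nat \<Rightarrow> nat) \<Rightarrow> (nat \<Rightarrow> nat)) \<Rightarrow> bool" where
  "locally_branching q n f \<longleftrightarrow>
     (\<forall>\<omega>\<in>cantor n. \<exists>u v \<tau>. \<tau> \<in> cantor n \<and> \<omega> = u \<frown> \<tau> \<and> branch q n f u v)"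

text \<open>A label \<open>q\<close> stands for the extra condition \<open>q u = q v\<close> on branches; a constant label gives $F_n$.\<close>

definition right_congruent :: "(nat list \<Rightarrow> 'q) \<Rightarrow> bool" where
  "right_congruent q \<longleftrightarrow> (\<forall>u v x. q u = q v \<longrightarrow> q (u @ x) = q (v @ x))"

definition label_F :: "(nat list \<Rightarrow> 'q) \<Rightarrow> nat \<Rightarrow> ((nat \<Rightarrow> nat) \<Rightarrow> (nat \<Rightarrow> nat)) set" where
  "label_F q n = {f \<in> Bij (cantor n). word_increasing (cantor n) f \<and> locally_branching q n f}"

lemma right_congruentD: "right_congruent q \<Longrightarrow> q u = q v \<Longrightarrow> q (u @ x) = q (v @ x)"
  unfolding right_congruent_def by blast

text \<open>Refining a branch by a common suffix keeps the labels equal because \<open>q\<close> is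
  right congruent; this is where that condition enters.\<close>

lemma branch_append:
  "right_congruent q \<Longrightarrow> branch q n f u v \<Longrightarrow> x \<in> lists {..<n} \<Longrightarrow> branch q n f (u @ x) (v @ x)"
  unfolding branch_def using right_congruentD[of q u v x] by (auto simp flip: conc_conc)

lemma locally_branchingE:
  assumes "locally_branching q n f" "\<omega> \<in> cantor n"
  obtains u v \<tau> where "\<tau> \<in> cantor n" "\<omega> = u \<frown> \<tau>" "f \<omega> = v \<frown> \<tau>" "branch q n f u v"
  using assms unfolding locally_branching_def branch_def by metis

text \<open>The order is total, so a strictly increasing bijection also reflects it.\<close>

lemma word_increasing_inv:
  assumes f: "bij_betw f S T" "word_increasing S f"
  shows "word_increasing T (inv_into S f)"
  unfolding word_increasing_def
proof (intro ballI impI)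
  fix \<alpha> \<beta> assume *: "\<alpha> \<in> T" "\<beta> \<in> T" "wless \<alpha> \<beta>"
  let ?g = "inv_into S f"
  have g: "?g \<alpha> \<in> S" "?g \<beta> \<in> S" "f (?g \<alpha>) = \<alpha>" "f (?g \<beta>) = \<beta>"
    using f(1) * bij_betw_inv_into_right[OF f(1)] by (auto simp: bij_betw_def inv_into_into)
  have "\<not> wless (?g \<beta>) (?g \<alpha>)"
  proof
    assume "wless (?g \<beta>) (?g \<alpha>)"
    then have "wless (f (?g \<beta>)) (f (?g \<alpha>))"
      using assms(2) g(1,2) unfolding word_increasing_def by blast
    then show False using *(3) wless_asym unfolding g(3,4) by blast
  qed
  moreover have "?g \<alpha> \<noteq> ?g \<beta>"
  proof
    assume "?g \<alpha> = ?g \<beta>"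
    then have "f (?g \<alpha>) = f (?g \<beta>)" by (rule arg_cong)
    then show False using *(3) unfolding g(3,4) by simp
  qed
  ultimately show "wless (?g \<alpha>) (?g \<beta>)"
    using wless_linear[of "?g \<alpha>" "?g \<beta>"] by simp
qed

lemma word_increasing_restrict [simp]: "word_increasing S (restrict f S) \<longleftrightarrow> word_increasing S f"
  by (simp add: word_increasing_def)

text \<open>A branch \<open>u\<close>, \<open>v\<close> of \<open>f\<close> is a branch
  \<open>v\<close>, \<open>u\<close> of the inverse.\<close>

lemma label_F_inv:
  assumes "f \<in> label_F q n"
  shows "restrict (inv_into (cantor n) f) (cantor n) \<in> label_F q n"
proof -
  let ?C = "cantor n" and ?g = "restrict (inv_into (cantor n) f) (cantor n)"
  have f: "f \<in> Bij ?C" "word_increasing ?C f" "locally_branching q n f"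
    using assms by (auto simp: label_F_def)
  have "locally_branching q n ?g"
    unfolding locally_branching_def
  proof
    fix \<omega> assume \<omega>: "\<omega> \<in> ?C"
    then have "inv_into ?C f \<omega> \<in> ?C" using f by (simp add: Bij_inv_into_mem)
    with f(3) obtain u v \<tau> where *: "\<tau> \<in> ?C" "f (inv_into ?C f \<omega>) = v \<frown> \<tau>" "branch q n f u v"
      by (rule locally_branchingE)
    then have "\<omega> = v \<frown> \<tau>" using f \<omega> by (simp add: Bij_inv_right)
    moreover have "branch q n ?g v u"
      unfolding branch_def
    proof (intro conjI ballI)
      fix \<sigma> assume \<sigma>: "\<sigma> \<in> ?C"
      then have "f (u \<frown> \<sigma>) = v \<frown> \<sigma>" "u \<frown> \<sigma> \<in> ?C" "v \<frown> \<sigma> \<in> ?C"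
        using *(3) by (auto simp: branch_def)
      then show "?g (v \<frown> \<sigma>) = u \<frown> \<sigma>" using Bij_inv_left[OF f(1), of "u \<frown> \<sigma>"] by simp
    qed (use *(3) in \<open>auto simp: branch_def\<close>)
    ultimately show "\<exists>u v \<tau>. \<tau> \<in> ?C \<and> \<omega> = u \<frown> \<tau> \<and> branch q n ?g u v" using * by blast
  qed
  then show ?thesis
    using f word_increasing_inv[of f ?C ?C]
    by (simp add: label_F_def restrict_inv_into_Bij) (simp add: Bij_def)
qed

lemma label_F_compose:
  assumes q: "right_congruent q" and "g \<in> label_F q n" "f \<in> label_F q n"
  shows "compose (cantor n) g f \<in> label_F q n"
proof -
  let ?C = "cantor n" and ?h = "compose (cantor n) g f"
  have f: "f \<in> Bij ?C" "word_increasing ?C f" "locally_branching q n f"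
    and g: "g \<in> Bij ?C" "word_increasing ?C g" "locally_branching q n g"
    using assms by (auto simp: label_F_def)
  have trans: "branch q n ?h u w" if "branch q n f u v" "branch q n g v w" for u v w
    using that by (auto simp: branch_def compose_def)
  have "locally_branching q n ?h"
    unfolding locally_branching_def
  proof
    fix \<omega> assume \<omega>: "\<omega> \<in> ?C"
    with f(3) obtain u v \<tau> where 1: "\<tau> \<in> ?C" "\<omega> = u \<frown> \<tau>" "f \<omega> = v \<frown> \<tau>" "branch q n f u v"
      by (rule locally_branchingE)
    have "f \<omega> \<in> ?C" using f \<omega> by (simp add: Bij_in_cantor)
    with g(3) obtain u' v' \<tau>' where 2: "\<tau>' \<in> ?C" "f \<omega> = u' \<frown> \<tau>'" "branch q n g u' v'"
      by (rule locally_branchingE)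
    \<comment> \<open>The range word of the branch of \<open>f\<close> and the domain word of the
      branch of \<open>g\<close> are both prefixes of \<open>f \<omega>\<close>, hence comparable.
      Refining the branch with the shorter one makes the two composable.\<close>
    consider x where "v = u' @ x" | x where "u' = v @ x"
      using conc_eq_imp_prefix[of v \<tau> u' \<tau>'] 1 2 by (auto simp: prefix_def)
    then show "\<exists>u v \<tau>. \<tau> \<in> ?C \<and> \<omega> = u \<frown> \<tau> \<and> branch q n ?h u v"
    proof cases
      case 1
      then have "branch q n g v (v' @ x)"
        using branch_append[OF q 2(3)] \<open>branch q n f u v\<close> by (auto simp: branch_def)
      then show ?thesis using trans \<open>branch q n f u v\<close> \<open>\<tau> \<in> ?C\<close> \<open>\<omega> = u \<frown> \<tau>\<close> by blast
    next
      case 2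
      have "x \<in> lists {..<n}" using 2 \<open>branch q n g u' v'\<close> by (auto simp: branch_def)
      then have "branch q n f (u @ x) u'" using branch_append[OF q \<open>branch q n f u v\<close>] 2 by simp
      then have "branch q n ?h (u @ x) v'" using trans \<open>branch q n g u' v'\<close> by blast
      moreover have "\<tau> = x \<frown> \<tau>'"
        using \<open>f \<omega> = v \<frown> \<tau>\<close> \<open>f \<omega> = u' \<frown> \<tau>'\<close> 2 by (simp flip: conc_conc)
      ultimately show ?thesis using \<open>\<omega> = u \<frown> \<tau>\<close> \<open>\<tau>' \<in> ?C\<close>
        by (intro exI[of _ "u @ x"] exI[of _ v'] exI[of _ \<tau>']) auto
    qed
  qed
  moreover have "word_increasing ?C ?h"
    using f g by (auto simp: word_increasing_def compose_def Bij_in_cantor)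
  ultimately show ?thesis using f g by (simp add: label_F_def compose_Bij)
qed

lemma label_F_id: "(\<lambda>x\<in>cantor n. x) \<in> label_F q n"
proof -
  have "branch q n (\<lambda>x\<in>cantor n. x) [] []" by (simp add: branch_def)
  then have "locally_branching q n (\<lambda>x\<in>cantor n. x)"
    unfolding locally_branching_def by (metis conc_empty)
  then show ?thesis by (simp add: label_F_def id_Bij word_increasing_def)
qed

lemma subgroup_label_F:
  assumes "right_congruent q"
  shows "subgroup (label_F q n) (BijGroup (cantor n))"
proof (rule group.subgroupI[OF group_BijGroup])
  show sub: "label_F q n \<subseteq> carrier (BijGroup (cantor n))"
    by (auto simp: label_F_def BijGroup_def)
  show "label_F q n \<noteq> {}" using label_F_id by blast
  fix f assume f: "f \<in> label_F q n"
  then have "f \<in> Bij (cantor n)" by (simp add: label_F_def)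
  then show "inv\<^bsub>BijGroup (cantor n)\<^esub> f \<in> label_F q n"
    using label_F_inv[OF f] by (simp add: inv_BijGroup)
  fix g assume g: "g \<in> label_F q n"
  then have "g \<in> Bij (cantor n)" by (simp add: label_F_def)
  then show "f \<otimes>\<^bsub>BijGroup (cantor n)\<^esub> g \<in> label_F q n"
    using label_F_compose[OF assms f g] \<open>f \<in> Bij (cantor n)\<close> by (simp add: BijGroup_def)
qed

section \<open>Tree diagrams\<close>

lemma mem_cylinder: "\<omega> \<in> cylinder n u \<longleftrightarrow> (\<exists>\<tau>\<in>cantor n. \<omega> = u \<frown> \<tau>)"
  by (auto simp: cylinder_def)

lemma complete_prefix_code_lists: "complete_prefix_code n U \<Longrightarrow> U \<subseteq> lists {..<n}"
  by (auto simp: complete_prefix_code_def prefix_code_def)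

lemma complete_prefix_codeE:
  assumes "complete_prefix_code n U" "\<omega> \<in> cantor n"
  obtains u \<tau> where "u \<in> U" "\<tau> \<in> cantor n" "\<omega> = u \<frown> \<tau>"
proof -
  from assms have "\<omega> \<in> (\<Union>u\<in>U. cylinder n u)"
    by (simp add: complete_prefix_code_def)
  then show ?thesis using that by (auto simp: mem_cylinder)
qed

lemma lexord_less_irrefl: "(u, u) \<notin> lexord {(a, b). a < (b :: nat)}"
  by (rule lexord_irreflexive) simp

lemma lex_sorted_code_less:
  assumes "complete_prefix_code n (set us)" "lex_sorted us" "i < j" "j < length us"
  shows "(us ! i, us ! j) \<in> lexord {(a, b). a < b}" "\<not> Sublist.prefix (us ! i) (us ! j)"
proof -
  show *: "(us ! i, us ! j) \<in> lexord {(a, b). a < b}"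
    using assms sorted_wrt_nth_less[of _ us i j] by (simp add: lex_sorted_def)
  show "\<not> Sublist.prefix (us ! i) (us ! j)"
  proof
    assume "Sublist.prefix (us ! i) (us ! j)"
    with assms have "us ! i = us ! j"
      by (simp add: complete_prefix_code_def prefix_code_def)
    with * show False using lexord_less_irrefl by metis
  qed
qed

lemma lex_sorted_code_wless:
  assumes "complete_prefix_code n (set us)" "lex_sorted us" "i < j" "j < length us"
  shows "wless (us ! i \<frown> \<alpha>) (us ! j \<frown> \<beta>)"
  using lex_sorted_code_less[OF assms] by (rule lexord_imp_wless)

text \<open>Points in different leaves compare as the leaves do, in the domain and in the range;
  within one leaf only a common prefix is replaced. So both lists being sorted makes
  \<open>f\<close> increasing.\<close>

lemma tree_diagram_imp_label_F:
  assumes f: "f \<in> Bij (cantor n)" and t: "tree_diagram n f us vs"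
    and q: "\<And>i. i < length us \<Longrightarrow> q (us ! i) = q (vs ! i)"
  shows "f \<in> label_F q n"
proof -
  have us: "complete_prefix_code n (set us)" "lex_sorted us"
    and vs: "complete_prefix_code n (set vs)" "lex_sorted vs"
    and len: "length us = length vs"
    and f_us: "\<And>i \<tau>. i < length us \<Longrightarrow> \<tau> \<in> cantor n \<Longrightarrow> f (us ! i \<frown> \<tau>) = vs ! i \<frown> \<tau>"
    using t by (auto simp: tree_diagram_def)
  have cover: "\<exists>i<length us. \<exists>\<tau>\<in>cantor n. \<omega> = us ! i \<frown> \<tau>" if "\<omega> \<in> cantor n" for \<omega>
    using complete_prefix_codeE[OF us(1) that] by (metis in_set_conv_nth)
  have branches: "branch q n f (us ! i) (vs ! i)" if "i < length us" for i
    using that q f_us len complete_prefix_code_lists[OF us(1)] complete_prefix_code_lists[OF vs(1)]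
    unfolding branch_def by (metis nth_mem subsetD)
  have "locally_branching q n f"
    unfolding locally_branching_def using cover branches by blast
  moreover have "word_increasing (cantor n) f"
    unfolding word_increasing_def
  proof (intro ballI impI)
    fix \<alpha> \<beta> assume *: "\<alpha> \<in> cantor n" "\<beta> \<in> cantor n" "wless \<alpha> \<beta>"
    obtain i \<sigma> where i: "i < length us" "\<sigma> \<in> cantor n" "\<alpha> = us ! i \<frown> \<sigma>"
      using cover[OF *(1)] by blast
    obtain j \<tau> where j: "j < length us" "\<tau> \<in> cantor n" "\<beta> = us ! j \<frown> \<tau>"
      using cover[OF *(2)] by blast
    have "\<not> j < i" using lex_sorted_code_wless[OF us, of j i \<tau> \<sigma>] *(3) i j wless_asym by metis
    then consider "i < j" | "i = j" by linarith
    then show "wless (f \<alpha>) (f \<beta>)"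
    proof cases
      case 1
      then show ?thesis using lex_sorted_code_wless[OF vs, of i j \<sigma> \<tau>] i j len by (simp add: f_us)
    next
      case 2
      then show ?thesis using * i j by (simp add: f_us)
    qed
  qed
  ultimately show ?thesis using f by (simp add: label_F_def)
qed

text \<open>
  Compactness in the form of Koenig's lemma: if no depth worked, the words below which no depth
  works would contain an infinite path.
\<close>

lemma uniform_depth:
  assumes loc: "locally_branching q n f" and q: "right_congruent q"
  obtains N where "\<And>u. u \<in> lists {..<n} \<Longrightarrow> length u = N \<Longrightarrow> \<exists>v. branch q n f u v"
proof -
  define good where
    "good u \<longleftrightarrow> (\<exists>N. \<forall>w\<in>lists {..<n}. length w = N \<longrightarrow> (\<exists>v. branch q n f (u @ w) v))" for u
  have step: "\<exists>x<n. \<not> good (u @ [x])" if bad: "\<not> good u" for u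
  proof (rule ccontr)
    assume "\<not> (\<exists>x<n. \<not> good (u @ [x]))"
    then have "\<forall>x\<in>{..<n}. \<exists>N. \<forall>w\<in>lists {..<n}. length w = N \<longrightarrow> (\<exists>v. branch q n f (u @ x # w) v)"
      by (simp add: good_def)
    then obtain N where N: "\<And>x w. x < n \<Longrightarrow> w \<in> lists {..<n} \<Longrightarrow> length w = N x
        \<Longrightarrow> \<exists>v. branch q n f (u @ x # w) v"
      by (metis lessThan_iff)
    \<comment> \<open>The sum bounds all the depths \<open>N x\<close> at once. The word after the
      letter \<open>x\<close> is cut at \<open>N x\<close>, and the branch found there is refined by
      the rest.\<close>
    have "\<exists>v. branch q n f (u @ w) v"
      if w: "w \<in> lists {..<n}" "length w = Suc (sum N {..<n})" for w
    proof -
      obtain x y where xy: "w = x # y" "x < n" "y \<in> lists {..<n}" "length y = sum N {..<n}"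
        using w by (cases w) auto
      have "N x \<le> sum N {..<n}" using xy(2) by (intro member_le_sum) auto
      then have "length (take (N x) y) = N x" using xy by simp
      moreover have "take (N x) y \<in> lists {..<n}" "drop (N x) y \<in> lists {..<n}"
        using xy(3) by (auto simp: in_lists_conv_set dest: in_set_takeD in_set_dropD)
      ultimately obtain v where "branch q n f (u @ x # take (N x) y) v"
        using N xy(2) by blast
      from branch_append[OF q this \<open>drop (N x) y \<in> lists {..<n}\<close>] show ?thesis
        unfolding xy(1) by (auto simp: append_take_drop_id)
    qed
    with bad show False unfolding good_def by blast
  qed
  have "good []"
  proof (rule ccontr)
    assume "\<not> good []"
    \<comment> \<open>An infinite path \<open>\<omega>\<close> is grown through words that are not
      good; \<open>P k\<close> is its prefix of length \<open>k\<close>.\<close>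
    define next_letter where "next_letter u = (SOME x. x < n \<and> \<not> good (u @ [x]))" for u
    define P where "P = rec_nat [] (\<lambda>_ u. u @ [next_letter u])"
    define \<omega> where "\<omega> k = next_letter (P k)" for k
    have nl: "next_letter u < n \<and> \<not> good (u @ [next_letter u])" if "\<not> good u" for u
      unfolding next_letter_def using someI_ex[OF step[OF that]] .
    have bad: "\<not> good (P k)" for k
      by (induction k) (use \<open>\<not> good []\<close> nl in \<open>auto simp: P_def\<close>)
    have P: "P k = \<omega> [0 \<rightarrow> k]" for k
      by (induction k) (auto simp: P_def \<omega>_def)
    have "\<omega> \<in> cantor n" using nl bad by (simp add: cantor_eq \<omega>_def)
    with loc obtain u v \<tau> where uv: "\<omega> = u \<frown> \<tau>" "branch q n f u v"
      by (rule locally_branchingE)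
    \<comment> \<open>The branch through \<open>\<omega>\<close> starts at a prefix \<open>u\<close>
      of the path, which is therefore good with depth 0.\<close>
    have "u = P (length u)" unfolding P uv(1) by simp
    moreover have "good u" unfolding good_def using uv(2) by (intro exI[of _ 0]) auto
    ultimately show False using bad by metis
  qed
  then obtain N where "\<forall>w\<in>lists {..<n}. length w = N \<longrightarrow> (\<exists>v. branch q n f w v)"
    by (auto simp: good_def)
  then show ?thesis using that by blast
qed

section \<open>From local branches to a tree diagram\<close>

primrec level :: "nat \<Rightarrow> nat \<Rightarrow> nat list list" where
  "level n 0 = [[]]"
| "level n (Suc k) = concat (map (\<lambda>x. map ((#) x) (level n k)) [0..<n])"

lemma set_level: "set (level n k) = {u \<in> lists {..<n}. length u = k}"
proof (induction k)
  case (Suc k)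
  have "u \<in> set (level n (Suc k)) \<longleftrightarrow> u \<in> lists {..<n} \<and> length u = Suc k" for u
    by (cases u) (auto simp: Suc)
  then show ?case by blast
qed auto

lemma lex_sorted_level: "lex_sorted (level n k)"
proof (induction k)
  case (Suc k)
  have "lex_sorted (concat (map (\<lambda>x. map ((#) x) (level n k)) xs))" if "sorted_wrt (<) xs" for xs
    using that
  proof (induction xs)
    case (Cons x xs)
    then show ?case using \<open>lex_sorted (level n k)\<close>
      by (auto simp: lex_sorted_def sorted_wrt_append sorted_wrt_map)
  qed (simp add: lex_sorted_def)
  then show ?case by simp
qed (simp add: lex_sorted_def)

lemma complete_prefix_code_level: "complete_prefix_code n (set (level n k))"
  unfolding complete_prefix_code_def prefix_code_def
proof (intro conjI)
  show "\<forall>u\<in>set (level n k). \<forall>v\<in>set (level n k). Sublist.prefix u v \<longrightarrow> u = v"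
    by (auto simp: set_level prefix_def)
  show "disjoint_family_on (cylinder n) (set (level n k))"
    by (auto simp: disjoint_family_on_def set_level mem_cylinder)
  show "(\<Union>u\<in>set (level n k). cylinder n u) = cantor n"
  proof (intro equalityI subsetI)
    fix \<omega> assume \<omega>: "\<omega> \<in> cantor n"
    have "\<omega> = \<omega> [0 \<rightarrow> k] \<frown> Omega_Words_Fun.suffix k \<omega>" by simp
    moreover have "\<omega> [0 \<rightarrow> k] \<in> set (level n k)"
      unfolding set_level using subsequence_in_lists[OF \<omega>] by simp
    ultimately show "\<omega> \<in> (\<Union>u\<in>set (level n k). cylinder n u)"
      using suffix_in_cantor[OF \<omega>] unfolding UN_iff mem_cylinder by metis
  qed (auto simp: set_level mem_cylinder)
  show "finite (set (level n k))" by simp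
  show "set (level n k) \<subseteq> lists {..<n}" by (auto simp: set_level)
qed

text \<open>The domain tree is the full tree of a uniform depth \<open>N\<close>, and each leaf gets
  some branch of \<open>f\<close>. Injectivity of \<open>f\<close> makes the range words a prefix
  code, surjectivity makes it complete, and monotonicity makes it sorted.\<close>

lemma label_F_imp_tree_diagram:
  assumes n: "0 < n" and q: "right_congruent q" and "f \<in> label_F q n"
  obtains us vs where "tree_diagram n f us vs" "\<And>i. i < length us \<Longrightarrow> q (us ! i) = q (vs ! i)"
proof -
  let ?C = "cantor n"
  have f: "f \<in> Bij ?C" "word_increasing ?C f" "locally_branching q n f"
    using assms by (auto simp: label_F_def)
  obtain N where N: "\<And>u. u \<in> lists {..<n} \<Longrightarrow> length u = N \<Longrightarrow> \<exists>v. branch q n f u v"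
    using uniform_depth[OF f(3) q] by blast
  define us where "us = level n N"
  define \<phi> where "\<phi> u = (SOME v. branch q n f u v)" for u
  define vs where "vs = map \<phi> us"
  have us: "set us = {u \<in> lists {..<n}. length u = N}" by (simp add: us_def set_level)
  have \<phi>: "branch q n f u (\<phi> u)" if "u \<in> set us" for u
    unfolding \<phi>_def by (rule someI_ex, rule N) (use that us in auto)
  have f_us: "f (u \<frown> \<tau>) = \<phi> u \<frown> \<tau>" if "u \<in> set us" "\<tau> \<in> ?C" for u \<tau>
    using \<phi>[OF that(1)] that(2) by (auto simp: branch_def)
  have \<phi>_lists: "\<phi> u \<in> lists {..<n}" if "u \<in> set us" for u
    using \<phi>[OF that(1)] by (auto simp: branch_def)
  have inj: "u = u'"
    if *: "u \<in> set us" "u' \<in> set us" "\<alpha> \<in> ?C" "\<beta> \<in> ?C" "\<phi> u \<frown> \<alpha> = \<phi> u' \<frown> \<beta>" for u u' \<alpha> \<beta>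
  proof -
    have "f (u \<frown> \<alpha>) = f (u' \<frown> \<beta>)" using * by (simp add: f_us)
    moreover have "u \<frown> \<alpha> \<in> ?C" "u' \<frown> \<beta> \<in> ?C" using * by (auto simp: us)
    ultimately have "u \<frown> \<alpha> = u' \<frown> \<beta>"
      by (rule Bij_injD[OF f(1)])
    then show ?thesis using * by (simp add: us)
  qed
  have inj_prefix: "u = u'" if *: "u \<in> set us" "u' \<in> set us" "Sublist.prefix (\<phi> u) (\<phi> u')" for u u'
  proof -
    obtain x where x: "\<phi> u' = \<phi> u @ x" using *(3) by (auto simp: prefix_def)
    then have "x \<in> lists {..<n}" using \<phi>_lists[OF *(2)] by simp
    \<comment> \<open>The tails \<open>x \<frown> (\<lambda>_. 0)\<close> and
      \<open>\<lambda>_. 0\<close> give the two cylinders a common image point. The zero tail exists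
      because \<open>0 < n\<close>.\<close>
    then show ?thesis
      using inj[OF *(1,2), of "x \<frown> (\<lambda>_. 0)" "\<lambda>_. 0"] cantor_nonempty[OF n] x by simp
  qed
  have "complete_prefix_code n (set vs)"
    unfolding complete_prefix_code_def prefix_code_def
  proof (intro conjI)
    show "set vs \<subseteq> lists {..<n}" using \<phi>_lists by (auto simp: vs_def)
    show "\<forall>u\<in>set vs. \<forall>v\<in>set vs. Sublist.prefix u v \<longrightarrow> u = v"
      unfolding vs_def using inj_prefix by auto
    show "disjoint_family_on (cylinder n) (set vs)"
      unfolding disjoint_family_on_def vs_def using inj by (fastforce simp: mem_cylinder)
    show "(\<Union>u\<in>set vs. cylinder n u) = ?C"
    proof (intro equalityI subsetI)
      fix \<omega> assume \<omega>: "\<omega> \<in> ?C"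
      then have "inv_into ?C f \<omega> \<in> ?C" using f by (simp add: Bij_inv_into_mem)
      with complete_prefix_code_level[of n N, folded us_def]
      obtain u \<tau> where u: "u \<in> set us" "\<tau> \<in> ?C" "inv_into ?C f \<omega> = u \<frown> \<tau>"
        by (rule complete_prefix_codeE)
      then have "\<omega> = \<phi> u \<frown> \<tau>" using f_us[OF u(1,2)] Bij_inv_right[OF f(1) \<omega>] by simp
      then show "\<omega> \<in> (\<Union>u\<in>set vs. cylinder n u)" using u by (auto simp: vs_def mem_cylinder)
    qed (use \<phi>_lists in \<open>auto simp: mem_cylinder vs_def\<close>)
  qed simp
  moreover have "lex_sorted vs"
    unfolding lex_sorted_def vs_def sorted_wrt_map
  proof (rule sorted_wrt_mono_rel[OF _ lex_sorted_level[of n N, folded us_def, unfolded lex_sorted_def]])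
    fix u u' assume *: "u \<in> set us" "u' \<in> set us" "(u, u') \<in> lexord {(a, b). a < b}"
    have "u \<noteq> u'" using *(3) lexord_less_irrefl by metis
    then have "\<not> Sublist.prefix u u'" using *(1,2) by (auto simp: us prefix_def)
    then have "wless (u \<frown> (\<lambda>_. 0)) (u' \<frown> (\<lambda>_. 0))" using *(3) by (simp add: lexord_imp_wless)
    then have "wless (\<phi> u \<frown> (\<lambda>_. 0)) (\<phi> u' \<frown> (\<lambda>_. 0))"
      using f(2) * cantor_nonempty[OF n] unfolding word_increasing_def
      by (metis (no_types, lifting) conc_in_cantor f_us mem_Collect_eq us)
    then show "(\<phi> u, \<phi> u') \<in> lexord {(a, b). a < b}"
      using \<open>u \<noteq> u'\<close> inj_prefix * by (metis wless_imp_lexord)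
  qed
  ultimately have "tree_diagram n f us vs"
    using complete_prefix_code_level[of n N] lex_sorted_level[of n N] f_us
    unfolding tree_diagram_def by (simp add: vs_def flip: us_def)
  moreover have "q (us ! i) = q (vs ! i)" if "i < length us" for i
    using \<phi>[of "us ! i"] that by (simp add: branch_def vs_def)
  ultimately show ?thesis using that by blast
qed

section \<open>Continuity, and the two groups in terms of labels\<close>

lemma cantor_top_cylinder_nbhd:
  assumes "\<omega> \<in> cantor n"
  shows "openin (cantor_top n) {\<omega>'\<in>cantor n. \<omega>' [0 \<rightarrow> k] = \<omega> [0 \<rightarrow> k]}"
proof -
  define X where "X j = (if j < k then {\<omega> j} else {..<n})" for j
  have "finite {j. X j \<noteq> topspace (discrete_topology {..<n})}"
    by (rule finite_subset[of _ "{..<k}"]) (auto simp: X_def)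
  moreover have "openin (discrete_topology {..<n}) (X j)" for j
    using assms by (auto simp: X_def cantor_eq)
  ultimately have "openin (cantor_top n) (PiE UNIV X)"
    unfolding cantor_top_def by (intro product_topology_basis)
  moreover have "PiE UNIV X = {\<omega>'\<in>cantor n. \<omega>' [0 \<rightarrow> k] = \<omega> [0 \<rightarrow> k]}"
    using assms by (auto simp: PiE_UNIV_domain X_def cantor_eq list_eq_iff_nth_eq split: if_splits)
  ultimately show ?thesis by simp
qed

text \<open>Each coordinate of \<open>f\<close> is locally constant, so \<open>f\<close> is
  continuous; a continuous bijection from a compact space to a Hausdorff space is a
  homeomorphism.\<close>

lemma label_F_homeomorphic:
  assumes "right_congruent q" "f \<in> label_F q n"
  shows "homeomorphic_map (cantor_top n) (cantor_top n) f"
proof -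
  let ?C = "cantor n"
  have f: "f \<in> Bij ?C" "locally_branching q n f"
    using assms by (auto simp: label_F_def)
  have cont: "continuous_map (cantor_top n) (discrete_topology {..<n}) (\<lambda>\<omega>. f \<omega> i)" for i
    unfolding continuous_map_def
  proof (intro conjI allI impI)
    show "(\<lambda>\<omega>. f \<omega> i) \<in> ?C \<rightarrow> topspace (discrete_topology {..<n})"
      using Bij_in_cantor[OF f(1)] by (auto simp: cantor_eq)
    fix S assume "openin (discrete_topology {..<n}) S"
    show "openin (cantor_top n) {\<omega> \<in> ?C. f \<omega> i \<in> S}"
    proof (subst openin_subopen, intro ballI)
      fix \<omega> assume \<omega>: "\<omega> \<in> {\<omega> \<in> ?C. f \<omega> i \<in> S}"
      then have "\<omega> \<in> ?C" by simp
      with f(2) obtain u v \<tau> where uv: "\<tau> \<in> ?C" "\<omega> = u \<frown> \<tau>" "branch q n f u v"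
        by (rule locally_branchingE)
      \<comment> \<open>With \<open>Suc i\<close> further letters the range word
        \<open>v @ x\<close> reaches past position \<open>i\<close> even if \<open>v\<close> is
        empty, so it fixes the coordinate \<open>i\<close> of the image.\<close>
      define x where "x = \<tau> [0 \<rightarrow> Suc i]"
      have br: "branch q n f (u @ x) (v @ x)"
        unfolding x_def by (rule branch_append[OF assms(1) uv(3) subsequence_in_lists[OF uv(1)]])
      have \<omega>_eq: "\<omega> = (u @ x) \<frown> Omega_Words_Fun.suffix (Suc i) \<tau>"
        unfolding uv(2) x_def by (simp flip: conc_conc)
      define T where "T = {\<omega>'\<in>?C. \<omega>' [0 \<rightarrow> length (u @ x)] = \<omega> [0 \<rightarrow> length (u @ x)]}"
      have "f \<omega>' i = (v @ x) ! i" if "\<omega>' \<in> T" for \<omega>'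
      proof -
        have "\<omega>' [0 \<rightarrow> length (u @ x)] = u @ x"
          using that \<omega>_eq unfolding T_def by (simp only: mem_Collect_eq prefix_conc_length)
        then have "\<omega>' = (u @ x) \<frown> Omega_Words_Fun.suffix (length (u @ x)) \<omega>'"
          by (metis Omega_Words_Fun.prefix_suffix)
        moreover have "Omega_Words_Fun.suffix (length (u @ x)) \<omega>' \<in> ?C"
          using that by (simp add: T_def)
        ultimately have "f \<omega>' = (v @ x) \<frown> Omega_Words_Fun.suffix (length (u @ x)) \<omega>'"
          using br unfolding branch_def by metis
        then show ?thesis by (simp add: x_def del: conc_conc)
      qed
      moreover have "\<omega> \<in> T" using \<omega> by (simp add: T_def)
      ultimately show "\<exists>T. openin (cantor_top n) T \<and> \<omega> \<in> T \<and> T \<subseteq> {\<omega> \<in> ?C. f \<omega> i \<in> S}"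
        using cantor_top_cylinder_nbhd[of \<omega> n "length (u @ x)"] \<omega>
        by (intro exI[of _ T]) (auto simp: T_def)
    qed
  qed
  have "continuous_map (cantor_top n) (product_topology (\<lambda>_. discrete_topology {..<n}) UNIV) f"
    unfolding continuous_map_componentwise_UNIV using cont by blast
  then have "continuous_map (cantor_top n) (cantor_top n) f" by (simp add: cantor_top_def)
  moreover have "compact_space (cantor_top n)" "Hausdorff_space (cantor_top n)"
    by (auto simp: cantor_top_def compact_space_product_topology compact_space_discrete_topology
        Hausdorff_space_product_topology)
  ultimately show ?thesis
    using f(1) by (intro continuous_imp_homeomorphic_map) (auto simp: Bij_def bij_betw_def)
qed

lemma right_congruent_const: "right_congruent (\<lambda>_. ())"
  by (simp add: right_congruent_def)

lemma F_carrier_eq: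
  assumes "0 < n"
  shows "F_carrier n = label_F (\<lambda>_. ()) n"
proof (intro equalityI subsetI)
  fix f assume "f \<in> F_carrier n"
  then show "f \<in> label_F (\<lambda>_. ()) n"
    by (auto simp: F_carrier_def intro: tree_diagram_imp_label_F)
next
  fix f assume f: "f \<in> label_F (\<lambda>_. ()) n"
  obtain us vs where "tree_diagram n f us vs"
    using label_F_imp_tree_diagram[OF assms right_congruent_const f] by metis
  then show "f \<in> F_carrier n"
    using f label_F_homeomorphic[OF right_congruent_const f]
    by (auto simp: F_carrier_def label_F_def)
qed

lemma right_congruent_jones_read: "right_congruent jones_read"
  by (simp add: right_congruent_def jones_read_def)

lemma jones_F3_eq: "jones_F3 = label_F jones_read 3"
proof (intro equalityI subsetI)
  fix f assume "f \<in> jones_F3"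
  then show "f \<in> label_F jones_read 3"
    by (auto simp: jones_F3_def F_carrier_def intro: tree_diagram_imp_label_F)
next
  fix f assume f: "f \<in> label_F jones_read 3"
  obtain us vs where "tree_diagram 3 f us vs" "\<And>i. i < length us \<Longrightarrow> jones_read (us ! i) = jones_read (vs ! i)"
    using label_F_imp_tree_diagram[OF _ right_congruent_jones_read f] by auto
  then show "f \<in> jones_F3"
    using f label_F_homeomorphic[OF right_congruent_jones_read f]
    unfolding jones_F3_def F_carrier_def label_F_def by blast
qed

section \<open>Digit sums of leaves\<close>

lemma card_words: "card {w \<in> lists {..<n :: nat}. length w = M} = n ^ M"
  using card_lists_length_eq[of "{..<n}" M] by (simp add: lists_eq_set)

lemma finite_words: "finite {w \<in> lists {..<n :: nat}. length w = M}"
  using finite_lists_length_eq[OF finite_lessThan, of n M] by (simp add: lists_eq_set)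

lemma card_extensions:
  assumes "v \<in> lists {..<n}" "length v \<le> M"
  shows "card {w \<in> lists {..<n}. length w = M \<and> Sublist.prefix v w} = n ^ (M - length v)"
proof -
  have "{w \<in> lists {..<n}. length w = M \<and> Sublist.prefix v w} =
      (@) v ` {w \<in> lists {..<n}. length w = M - length v}"
    using assms by (auto simp: prefix_def image_iff)
  then show ?thesis by (simp add: card_image card_words inj_on_def)
qed

text \<open>\<open>Suc m\<close> is 1 modulo \<open>m\<close>. The right side is
  \<open>1 mod m\<close> rather than 1 so that \<open>m = 1\<close> is covered.\<close>

lemma power_Suc_mod: "Suc m ^ k mod m = 1 mod m"
  by (induction k) (simp_all add: mod_simps flip: mod_mult_right_eq)

text \<open>Casting out nines: the count is the value in base \<open>Suc m\<close> of
  \<open>v\<close> padded with zeros to length \<open>M\<close>. Inductively, each of the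
  \<open>x\<close> smaller first letters contributes a power of \<open>Suc m\<close>, which is 1
  modulo \<open>m\<close>, and the first letter \<open>x\<close> itself leaves the count for the
  remaining word.\<close>

lemma card_lex_below:
  assumes "v \<in> lists {..<Suc m}" "length v \<le> M"
  shows "card {w \<in> lists {..<Suc m}. length w = M \<and> (w, v) \<in> lexord {(a, b). a < b}} mod m
    = sum_list v mod m"
  using assms
proof (induction v arbitrary: M rule: list.induct)
  case (Cons x v)
  let ?W = "\<lambda>k. {w \<in> lists {..<Suc m}. length w = k}"
  let ?B = "\<lambda>k v. {w \<in> lists {..<Suc m}. length w = k \<and> (w, v) \<in> lexord {(a, b). a < b}}"
  from Cons.prems obtain k where k: "M = Suc k" "length v \<le> k" by (cases M) auto
  have "w \<in> ?B (Suc k) (x # v) \<longleftrightarrow>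
      w \<in> (\<lambda>(y, w). y # w) ` ({..<x} \<times> ?W k) \<union> (#) x ` ?B k v" for w
    using Cons.prems(1) by (cases w) (auto simp: image_iff)
  then have eq: "?B (Suc k) (x # v) = (\<lambda>(y, w). y # w) ` ({..<x} \<times> ?W k) \<union> (#) x ` ?B k v"
    by blast
  have mod_eq: "(x * a + b) mod m = (x * (a mod m) + b mod m) mod m" for a b
    using mod_add_eq[of "x * a" m b] mod_add_eq[of "x * (a mod m)" m b] by (simp add: mod_mult_right_eq mod_add_right_eq)
  have fin: "finite (?B k v)" by (rule finite_subset[OF _ finite_words[of "Suc m" k]]) auto
  have "card (?B (Suc k) (x # v)) = card ((\<lambda>(y, w). y # w) ` ({..<x} \<times> ?W k)) + card ((#) x ` ?B k v)"
    unfolding eq using fin finite_words[of "Suc m" k] by (intro card_Un_disjoint) auto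
  also have "card ((\<lambda>(y, w). y # w) ` ({..<x} \<times> ?W k)) = x * Suc m ^ k"
    by (subst card_image) (auto simp: inj_on_def card_cartesian_product card_words)
  also have "card ((#) x ` ?B k v) = card (?B k v)" by (simp add: card_image)
  finally have "card (?B M (x # v)) mod m = (x * (Suc m ^ k mod m) + card (?B k v) mod m) mod m"
    unfolding k(1) by (simp only: mod_eq[of "Suc m ^ k" "card (?B k v)"])
  also have "\<dots> = (x + sum_list v) mod m"
    using Cons.IH[of k] Cons.prems k(2) unfolding power_Suc_mod by (simp add: mod_simps)
  finally show ?case by simp
qed simp

text \<open>
  Both sides count, modulo \<open>m\<close>, the words of a large length that are lexicographically below \<open>us ! i\<close>:
  each earlier code word has a power of \<open>Suc m\<close> many extensions.
\<close>

lemma digit_sum_code_nth: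
  assumes us: "complete_prefix_code (Suc m) (set us)" "lex_sorted us" and i: "i < length us"
  shows "sum_list (us ! i) mod m = i mod m"
proof -
  let ?n = "Suc m"
  \<comment> \<open>A length that no leaf exceeds, so each leaf has extensions of length
    \<open>M\<close>; \<open>E j\<close> collects those of leaf \<open>j\<close>.\<close>
  define M where "M = sum_list (map length us)"
  have len: "length (us ! j) \<le> M" if "j < length us" for j
    unfolding M_def using that by (intro member_le_sum_list) auto
  have lists: "us ! j \<in> lists {..<?n}" if "j < length us" for j
    using complete_prefix_code_lists[OF us(1)] that nth_mem by blast
  define E where "E j = {w \<in> lists {..<?n}. length w = M \<and> Sublist.prefix (us ! j) w}" for j
  have trans: "trans {(a, b). a < (b::nat)}" by (auto intro: transI)
  have asym: "asym {(a, b). a < (b::nat)}" by (auto intro: asymI)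
  have below: "(us ! j @ x, us ! i) \<in> lexord {(a, b). a < b} \<longleftrightarrow> j < i"
    if j: "j < length us" for j x
  proof -
    have "(us ! j @ x, us ! i) \<in> lexord {(a, b). a < b}" if "j < i"
    proof -
      have "wless (us ! j \<frown> x \<frown> (\<lambda>_. 0)) (us ! i \<frown> (\<lambda>_. 0))"
        using lex_sorted_code_wless[OF us that i] .
      then have "wless ((us ! j @ x) \<frown> (\<lambda>_. 0)) (us ! i \<frown> (\<lambda>_. 0))" by simp
      then show ?thesis
      proof (rule wless_imp_lexord)
        show "\<not> Sublist.prefix (us ! j @ x) (us ! i)"
          using lex_sorted_code_less(2)[OF us that i] append_prefixD by metis
        show "\<not> Sublist.prefix (us ! i) (us ! j @ x)"
        proof
          assume "Sublist.prefix (us ! i) (us ! j @ x)"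
          then have "Sublist.prefix (us ! i) (us ! j) \<or> Sublist.prefix (us ! j) (us ! i)"
            using prefix_same_cases by (metis prefixI)
          then have "us ! i = us ! j"
            using us(1) i j unfolding complete_prefix_code_def prefix_code_def by (metis nth_mem)
          then show False using lex_sorted_code_less(2)[OF us that i] by simp
        qed
      qed
    qed
    moreover have "(us ! j @ x, us ! i) \<notin> lexord {(a, b). a < b}" if "\<not> j < i"
    proof
      assume less: "(us ! j @ x, us ! i) \<in> lexord {(a, b). a < b}"
      have "(us ! i, us ! j @ x) \<in> lexord {(a, b). a < b} \<or> us ! i = us ! j @ x"
      proof (cases "i = j")
        case True
        then show ?thesis by (cases x) (auto intro: lexord_append_rightI)
      next
        case False
        with that have "i < j" by simp
        from lex_sorted_code_less(1)[OF us this j] have "(us ! i, us ! j) \<in> lexord {(a, b). a < b}" .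
        moreover have "(us ! j, us ! j @ x) \<in> lexord {(a, b). a < b} \<or> x = []"
          by (cases x) (auto intro: lexord_append_rightI)
        ultimately show ?thesis using lexord_trans[OF _ _ trans] by auto
      qed
      then show False using less lexord_asymmetric[OF asym] lexord_less_irrefl by metis
    qed
    ultimately show ?thesis by blast
  qed
  \<comment> \<open>By completeness every word of length \<open>M\<close> extends some leaf, and by
    \<open>below\<close> it precedes leaf \<open>i\<close> exactly if that leaf has a smaller
    index.\<close>
  have "{w \<in> lists {..<?n}. length w = M \<and> (w, us ! i) \<in> lexord {(a, b). a < b}} = (\<Union>j<i. E j)"
  proof (intro equalityI subsetI)
    fix w assume w: "w \<in> {w \<in> lists {..<?n}. length w = M \<and> (w, us ! i) \<in> lexord {(a, b). a < b}}"
    then have "w \<frown> (\<lambda>_. 0) \<in> cantor ?n" using cantor_nonempty[of ?n] by simp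
    with us(1) obtain u \<tau> where u: "u \<in> set us" "w \<frown> (\<lambda>_. 0) = u \<frown> \<tau>"
      by (rule complete_prefix_codeE)
    then obtain j where j: "j < length us" "u = us ! j" by (metis in_set_conv_nth)
    have "length u \<le> length w" using len[OF j(1)] j(2) w by simp
    then have "Sublist.prefix u w" using conc_eq_imp_prefix[OF u(2)] prefix_length_le
      by (metis prefix_length_prefix prefix_order.order_refl)
    then obtain x where "w = us ! j @ x" using j by (auto simp: prefix_def)
    then have "j < i" using below[OF j(1)] w by simp
    moreover have "w \<in> E j" using w \<open>w = us ! j @ x\<close> by (simp add: E_def)
    ultimately show "w \<in> (\<Union>j<i. E j)" by blast
  next
    fix w assume "w \<in> (\<Union>j<i. E j)"
    then obtain j x where j: "j < i" "w = us ! j @ x" and w: "w \<in> lists {..<?n}" "length w = M"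
      unfolding E_def prefix_def by blast
    then show "w \<in> {w \<in> lists {..<?n}. length w = M \<and> (w, us ! i) \<in> lexord {(a, b). a < b}}"
      using below[of j x] i j(1) unfolding j(2) by simp
  qed
  moreover have "card (\<Union>j<i. E j) = (\<Sum>j<i. card (E j))"
  proof (rule card_UN_disjoint)
    show "\<forall>j\<in>{..<i}. finite (E j)"
      unfolding E_def by (auto intro: finite_subset[OF _ finite_words[of ?n M]])
    show "\<forall>j\<in>{..<i}. \<forall>k\<in>{..<i}. j \<noteq> k \<longrightarrow> E j \<inter> E k = {}"
    proof (intro ballI impI)
      fix j k assume jk: "j \<in> {..<i}" "k \<in> {..<i}" "j \<noteq> k"
      have False if "w \<in> E j" "w \<in> E k" for w
      proof -
        have "Sublist.prefix (us ! j) (us ! k) \<or> Sublist.prefix (us ! k) (us ! j)"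
          using that prefix_same_cases unfolding E_def by blast
        then show False
          using jk i us(1) lex_sorted_code_less(2)[OF us, of j k] lex_sorted_code_less(2)[OF us, of k j]
          unfolding complete_prefix_code_def prefix_code_def
          by (metis lessThan_iff linorder_neqE_nat nth_mem order_less_trans)
      qed
      then show "E j \<inter> E k = {}" by blast
    qed
  qed simp
  moreover have "(\<Sum>j<i. card (E j)) = (\<Sum>j<i. ?n ^ (M - length (us ! j)))"
    using i by (intro sum.cong) (auto simp: E_def intro!: card_extensions lists len)
  ultimately have "sum_list (us ! i) mod m = (\<Sum>j<i. ?n ^ (M - length (us ! j))) mod m"
    using card_lex_below[OF lists[OF i] len[OF i]] by simp
  also have "\<dots> = (\<Sum>j<i. ?n ^ (M - length (us ! j)) mod m) mod m"
    by (rule mod_sum_eq[symmetric])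
  also have "\<dots> = (\<Sum>j<i. 1 mod m) mod m" by (simp only: power_Suc_mod)
  also have "\<dots> = i mod m" unfolding mod_sum_eq by simp
  finally show ?thesis .
qed

text \<open>Leaves with the same index in two trees have the same digit sum modulo \<open>m\<close>,
  so every tree diagram respects this label. It is the invariant from which the state of the
  transducer is recovered.\<close>

lemma F_carrier_eq_digit_sum: "F_carrier (Suc m) = label_F (\<lambda>u. sum_list u mod m) (Suc m)"
proof (intro equalityI subsetI)
  fix f assume "f \<in> F_carrier (Suc m)"
  then obtain us vs where "f \<in> Bij (cantor (Suc m))" and t: "tree_diagram (Suc m) f us vs"
    by (auto simp: F_carrier_def)
  moreover have "sum_list (us ! i) mod m = sum_list (vs ! i) mod m" if "i < length us" for i
    using t that digit_sum_code_nth[of m us i] digit_sum_code_nth[of m vs i]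
    by (simp add: tree_diagram_def)
  ultimately show "f \<in> label_F (\<lambda>u. sum_list u mod m) (Suc m)" by (rule tree_diagram_imp_label_F)
next
  fix f assume "f \<in> label_F (\<lambda>u. sum_list u mod m) (Suc m)"
  then show "f \<in> F_carrier (Suc m)"
    by (auto simp: F_carrier_eq label_F_def locally_branching_def branch_def) blast
qed

section \<open>The transducer\<close>

text \<open>
  In state \<open>Eta00\<close> or \<open>Eta11\<close> the cylinder of the input read so far corresponds to the cylinder of
  the output; in state \<open>Eta01\<close> (\<open>Eta10\<close>) it corresponds to the part of that cylinder
  where the next letter is 0 or 1 (1 or 2).
\<close>

primrec trans_out :: "jones_state \<Rightarrow> nat \<Rightarrow> nat list" where
  "trans_out Eta00 c = [[0], [1], [2], [2, 2]] ! c"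
| "trans_out Eta11 c = [[0, 0], [0], [1], [2]] ! c"
| "trans_out Eta01 c = [[0], [0, 2], [1, 0], [1]] ! c"
| "trans_out Eta10 c = [[1], [1, 2], [2, 0], [2]] ! c"

abbreviation jones_run :: "jones_state \<Rightarrow> nat list \<Rightarrow> jones_state" where
  "jones_run \<equiv> foldl jones_step"

primrec trans_word :: "jones_state \<Rightarrow> nat list \<Rightarrow> nat list" where
  "trans_word s [] = []"
| "trans_word s (c # w) = trans_out s c @ trans_word (jones_run s (trans_out s c)) w"

abbreviation trans_state :: "jones_state \<Rightarrow> nat list \<Rightarrow> jones_state" where
  "trans_state s w \<equiv> jones_run s (trans_word s w)"

text \<open>Each letter has nonempty output, so \<open>Suc i\<close> input letters determine the output letter \<open>i\<close>.\<close>

definition transduce :: "jones_state \<Rightarrow> (nat \<Rightarrow> nat) \<Rightarrow> (nat \<Rightarrow> nat)" where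
  "transduce s \<omega> = (\<lambda>i. trans_word s (\<omega> [0 \<rightarrow> Suc i]) ! i)"

definition first_letters :: "jones_state \<Rightarrow> nat set" where
  "first_letters s = {..<3} - (case s of Eta01 \<Rightarrow> {2} | Eta10 \<Rightarrow> {0} | _ \<Rightarrow> {})"

lemma first_letters_simps [simp]:
  "first_letters Eta00 = {0, 1, 2}" "first_letters Eta11 = {0, 1, 2}"
  "first_letters Eta01 = {0, 1}" "first_letters Eta10 = {1, 2}"
  by (auto simp: first_letters_def)

lemma less_4_cases:
  fixes c :: nat
  assumes "c < 4"
  obtains "c = 0" | "c = 1" | "c = 2" | "c = 3"
  using assms by linarith

lemma trans_out_lists: "c < 4 \<Longrightarrow> trans_out s c \<in> lists {..<3}"
  by (erule less_4_cases; cases s; simp)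

lemma trans_out_nonempty: "c < 4 \<Longrightarrow> trans_out s c \<noteq> []"
  by (erule less_4_cases; cases s; simp)

lemma hd_trans_out: "c < 4 \<Longrightarrow> hd (trans_out s c) \<in> first_letters s"
  by (erule less_4_cases; cases s; simp)

lemma trans_word_append:
  "trans_word s (u @ v) = trans_word s u @ trans_word (trans_state s u) v"
  by (induction u arbitrary: s) auto

lemma trans_word_lists: "w \<in> lists {..<4} \<Longrightarrow> trans_word s w \<in> lists {..<3}"
proof (induction w arbitrary: s)
  case (Cons c w)
  then show ?case using trans_out_lists[of c s] by simp
qed simp

lemma length_trans_word: "w \<in> lists {..<4} \<Longrightarrow> length w \<le> length (trans_word s w)"
proof (induction w arbitrary: s)
  case (Cons c w)
  have "Suc 0 \<le> length (trans_out s c)"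
    using Cons.prems trans_out_nonempty[of c s] by (cases "trans_out s c") auto
  moreover have "length w \<le> length (trans_word (jones_run s (trans_out s c)) w)"
    using Cons by simp
  ultimately show ?case by simp
qed simp

text \<open>The output on a longer input prefix extends the output on a shorter one, so every input
  prefix of more than \<open>i\<close> letters yields the same letter at position
  \<open>i\<close>.\<close>

lemma transduce_nth:
  assumes "\<omega> \<in> cantor 4" "i < m"
  shows "transduce s \<omega> i = trans_word s (\<omega> [0 \<rightarrow> m]) ! i"
proof -
  have "\<omega> [0 \<rightarrow> m] = \<omega> [0 \<rightarrow> Suc i] @ \<omega> [Suc i \<rightarrow> m]"
    using subsequence_append[of \<omega> "Suc i" "m - Suc i"] assms(2) by simp
  moreover have "i < length (trans_word s (\<omega> [0 \<rightarrow> Suc i]))"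
    using length_trans_word[OF subsequence_in_lists[OF assms(1), of 0 "Suc i"], of s]
    unfolding subsequence_length by linarith
  ultimately show ?thesis by (simp only: transduce_def trans_word_append nth_append if_True)
qed

lemma transduce_conc:
  assumes w: "w \<in> lists {..<4}" and \<tau>: "\<tau> \<in> cantor 4"
  shows "transduce s (w \<frown> \<tau>) = trans_word s w \<frown> transduce (trans_state s w) \<tau>"
proof
  fix i
  let ?l = "length (trans_word s w)" and ?m = "length w + Suc i"
  have in4: "w \<frown> \<tau> \<in> cantor 4" using assms by simp
  have pre: "(w \<frown> \<tau>) [0 \<rightarrow> ?m] = w @ \<tau> [0 \<rightarrow> Suc i]"
    by (subst prefix_conc_snd) simp_all
  have "transduce s (w \<frown> \<tau>) i = trans_word s ((w \<frown> \<tau>) [0 \<rightarrow> ?m]) ! i"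
    by (rule transduce_nth[OF in4]) simp
  also have "\<dots> = (trans_word s w @ trans_word (trans_state s w) (\<tau> [0 \<rightarrow> Suc i])) ! i"
    by (simp only: pre trans_word_append)
  also have "\<dots> = (trans_word s w \<frown> transduce (trans_state s w) \<tau>) i"
  proof (cases "i < ?l")
    case False
    then show ?thesis
      using transduce_nth[OF \<tau>, of "i - ?l" "Suc i"] by (simp add: nth_append del: subseq_to_Suc)
  qed (simp add: nth_append)
  finally show "transduce s (w \<frown> \<tau>) i = (trans_word s w \<frown> transduce (trans_state s w) \<tau>) i" .
qed

lemma transduce_build:
  assumes "c < 4" "\<tau> \<in> cantor 4"
  shows "transduce s (c ## \<tau>) = trans_out s c \<frown> transduce (jones_run s (trans_out s c)) \<tau>"
  using transduce_conc[of "[c]" \<tau> s] assms by simp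

text \<open>The image of \<open>transduce s\<close>, by \<open>transduce_in_range\<close> and
  \<open>transduce_surj\<close>.\<close>

definition transduce_range :: "jones_state \<Rightarrow> (nat \<Rightarrow> nat) set" where
  "transduce_range s = {\<sigma> \<in> cantor 3. \<sigma> 0 \<in> first_letters s}"

lemma build_in_cantor [simp]: "a ## \<alpha> \<in> cantor n \<longleftrightarrow> a < n \<and> \<alpha> \<in> cantor n"
  using conc_in_cantor[of "[a]" \<alpha> n] by simp

lemma cantor_buildE:
  assumes "\<omega> \<in> cantor n"
  obtains a \<alpha> where "\<omega> = a ## \<alpha>" "a < n" "\<alpha> \<in> cantor n"
  using assms by (metis build_first build_in_cantor)

lemma transduce_in_range:
  assumes "\<omega> \<in> cantor 4"
  shows "transduce s \<omega> \<in> transduce_range s"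
proof -
  have "transduce s \<omega> i < 3" for i
  proof -
    have w: "\<omega> [0 \<rightarrow> Suc i] \<in> lists {..<4}" using assms by (rule subsequence_in_lists)
    have "i < length (trans_word s (\<omega> [0 \<rightarrow> Suc i]))"
      using length_trans_word[OF w, of s] unfolding subsequence_length by linarith
    then show ?thesis
      using trans_word_lists[OF w, of s] nth_mem unfolding transduce_def by fastforce
  qed
  moreover have "transduce s \<omega> 0 \<in> first_letters s"
  proof -
    obtain c \<tau> where "\<omega> = c ## \<tau>" "c < 4" "\<tau> \<in> cantor 4"
      using assms by (rule cantor_buildE)
    then show ?thesis
      using hd_trans_out[of c s] trans_out_nonempty[of c s]
      by (simp add: transduce_build conc_def hd_conv_nth)
  qed
  ultimately show ?thesis by (simp add: transduce_range_def cantor_eq)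
qed

lemma transduce_first: "\<omega> \<in> cantor 4 \<Longrightarrow> transduce s \<omega> 0 \<in> first_letters s"
  using transduce_in_range by (auto simp: transduce_range_def)

lemma wless_first: "\<alpha> 0 < \<beta> 0 \<Longrightarrow> wless \<alpha> \<beta>"
  unfolding wless_def by (intro exI[of _ 0]) simp

lemma transduce_increasing: "word_increasing (cantor 4) (transduce s)"
  unfolding word_increasing_def
proof (intro ballI impI)
  fix \<alpha> \<beta> assume *: "\<alpha> \<in> cantor 4" "\<beta> \<in> cantor 4" "wless \<alpha> \<beta>"
  from *(3) obtain k where k: "\<And>i. i < k \<Longrightarrow> \<alpha> i = \<beta> i" "\<alpha> k < \<beta> k"
    by (auto simp: wless_def)
  define w where "w = \<alpha> [0 \<rightarrow> k]"
  have "w = \<beta> [0 \<rightarrow> k]" using k(1) by (auto simp: w_def list_eq_iff_nth_eq)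
  have w: "w \<in> lists {..<4}" unfolding w_def using *(1) by (rule subsequence_in_lists)
  obtain a \<alpha>' where a: "Omega_Words_Fun.suffix k \<alpha> = a ## \<alpha>'" "a < 4" "\<alpha>' \<in> cantor 4"
    using suffix_in_cantor[OF *(1)] by (rule cantor_buildE)
  obtain b \<beta>' where b: "Omega_Words_Fun.suffix k \<beta> = b ## \<beta>'" "b < 4" "\<beta>' \<in> cantor 4"
    using suffix_in_cantor[OF *(2)] by (rule cantor_buildE)
  have "a = \<alpha> k" "b = \<beta> k" using fun_cong[OF a(1), of 0] fun_cong[OF b(1), of 0] by auto
  with k(2) have "a < b" by simp
  \<comment> \<open>Where one output is a prefix of the other, as \<open>[2]\<close> and
    \<open>[2, 2]\<close> from \<open>Eta00\<close>, the shorter one leads to \<open>Eta01\<close>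
    or \<open>Eta10\<close>. The next letter is then below 2 or above 0 respectively, which decides
    the comparison.\<close>
  have "wless (transduce t (a ## \<alpha>')) (transduce t (b ## \<beta>'))" for t
    using \<open>a < b\<close> a(2,3) b(2,3) transduce_first[OF a(3), of Eta01] transduce_first[OF b(3), of Eta10]
    by (elim less_4_cases; cases t) (auto simp: transduce_build wless_build intro!: wless_first)
  moreover have "\<alpha> = w \<frown> a ## \<alpha>'" "\<beta> = w \<frown> b ## \<beta>'"
    using a(1) b(1) \<open>w = \<beta> [0 \<rightarrow> k]\<close> by (metis w_def Omega_Words_Fun.prefix_suffix)+
  ultimately show "wless (transduce s \<alpha>) (transduce s \<beta>)"
    using w a b by (simp add: transduce_conc)
qed

text \<open>Two letters of \<open>\<sigma>\<close> suffice to choose \<open>c\<close>. A two-letter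
  output always leads to \<open>Eta00\<close> or \<open>Eta11\<close>, where any continuation is
  allowed; after a one-letter output the second letter shows whether the new state permits
  it.\<close>

lemma transduce_parse:
  assumes "\<sigma> \<in> transduce_range s"
  obtains c \<rho> where "c < 4" "\<rho> \<in> transduce_range (jones_run s (trans_out s c))"
    "\<sigma> = trans_out s c \<frown> \<rho>"
proof -
  from assms have "\<sigma> \<in> cantor 3" "\<sigma> 0 \<in> first_letters s" by (auto simp: transduce_range_def)
  then obtain a \<sigma>' where a: "\<sigma> = a ## \<sigma>'" "a < 3" "\<sigma>' \<in> cantor 3" by (metis cantor_buildE)
  then obtain b \<rho> where b: "\<sigma>' = b ## \<rho>" "b < 3" "\<rho> \<in> cantor 3" by (metis cantor_buildE)
  have "a \<in> first_letters s" using \<open>\<sigma> 0 \<in> first_letters s\<close> a by simp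
  have "\<rho> 0 < 3" using b(3) by (simp add: cantor_eq)
  define P where "P c \<longleftrightarrow> (\<exists>\<rho>\<in>transduce_range (jones_run s (trans_out s c)). \<sigma> = trans_out s c \<frown> \<rho>)" for c
  have "P 0 \<or> P 1 \<or> P 2 \<or> P 3"
    using \<open>a \<in> first_letters s\<close> \<open>\<rho> 0 < 3\<close> a b unfolding P_def transduce_range_def
    by (cases s) (auto simp: less_Suc_eq eval_nat_numeral)
  then have "\<exists>c<4. P c" by (elim disjE) (auto intro: exI[of _ 0] exI[of _ 1] exI[of _ 2] exI[of _ 3])
  then show ?thesis using that by (auto simp: P_def)
qed

lemma transduce_surj:
  assumes "\<sigma> \<in> transduce_range s"
  obtains \<omega> where "\<omega> \<in> cantor 4" "transduce s \<omega> = \<sigma>"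
proof -
  have "\<forall>p. \<exists>r. snd p \<in> transduce_range (fst p) \<longrightarrow> fst r < 4 \<and>
      snd r \<in> transduce_range (jones_run (fst p) (trans_out (fst p) (fst r))) \<and>
      snd p = trans_out (fst p) (fst r) \<frown> snd r"
    by (metis transduce_parse fst_conv snd_conv)
  then obtain r where r: "\<And>t \<rho>. \<rho> \<in> transduce_range t \<Longrightarrow> fst (r (t, \<rho>)) < 4 \<and>
      snd (r (t, \<rho>)) \<in> transduce_range (jones_run t (trans_out t (fst (r (t, \<rho>))))) \<and>
      \<rho> = trans_out t (fst (r (t, \<rho>))) \<frown> snd (r (t, \<rho>))"
    by (metis fst_conv snd_conv)
  \<comment> \<open>Parsing is iterated: \<open>X k\<close> holds the state after \<open>k\<close>
    input letters and the part of \<open>\<sigma>\<close> still to be produced. Every input letter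
    outputs at least one letter, so each position of \<open>\<sigma>\<close> is eventually
    covered.\<close>
  define X where "X = rec_nat (s, \<sigma>) (\<lambda>_ p. (jones_run (fst p) (trans_out (fst p) (fst (r p))), snd (r p)))"
  define \<omega> where "\<omega> k = fst (r (X k))" for k
  have X_Suc: "X (Suc k) = (jones_run (fst (X k)) (trans_out (fst (X k)) (\<omega> k)), snd (r (X k)))" for k
    by (simp add: X_def \<omega>_def)
  have X_range: "snd (X k) \<in> transduce_range (fst (X k))" for k
  proof (induction k)
    case (Suc k)
    then show ?case using r[of "snd (X k)" "fst (X k)"] by (simp add: X_Suc \<omega>_def)
  qed (simp add: X_def assms)
  have \<omega>: "\<omega> \<in> cantor 4"
    using r[OF X_range] by (simp add: cantor_eq \<omega>_def)
  have inv: "fst (X k) = trans_state s (\<omega> [0 \<rightarrow> k]) \<and> \<sigma> = trans_word s (\<omega> [0 \<rightarrow> k]) \<frown> snd (X k)" for k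
  proof (induction k)
    case (Suc k)
    have "snd (X k) = trans_out (fst (X k)) (\<omega> k) \<frown> snd (X (Suc k))"
      using r[OF X_range[of k]] by (simp add: X_Suc \<omega>_def)
    with Suc show ?case by (simp add: trans_word_append X_Suc)
  qed (simp add: X_def)
  have "transduce s \<omega> i = \<sigma> i" for i
  proof -
    have "i < length (trans_word s (\<omega> [0 \<rightarrow> Suc i]))"
      using length_trans_word[OF subsequence_in_lists[OF \<omega>, of 0 "Suc i"], of s]
      unfolding subsequence_length by linarith
    then show ?thesis using inv[of "Suc i"] unfolding transduce_def by (metis conc_fst)
  qed
  then show ?thesis using that \<omega> by blast
qed

text \<open>The same parsing for finite words. It never gets stuck at the end, since in every state
  each permitted first letter is by itself the output of some input letter.\<close>

lemma trans_word_surj: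
  assumes "y \<in> lists {..<3}" "y = [] \<or> hd y \<in> first_letters s"
  shows "\<exists>w\<in>lists {..<4}. trans_word s w = y"
  using assms
proof (induction y arbitrary: s rule: length_induct)
  case (1 y)
  show ?case
  proof (cases "y = []")
    case False
    then obtain a z where y: "y = a # z" by (cases y) auto
    have "tl z \<noteq> [] \<Longrightarrow> hd (tl z) < 3"
      using "1.prems"(1) y by (cases z; cases "tl z") auto
    define P where "P c \<longleftrightarrow> (\<exists>x. y = trans_out s c @ x \<and>
      (x = [] \<or> hd x \<in> first_letters (jones_run s (trans_out s c))))" for c
    have "P 0 \<or> P 1 \<or> P 2 \<or> P 3"
      using "1.prems" \<open>tl z \<noteq> [] \<Longrightarrow> hd (tl z) < 3\<close> unfolding P_def y
      by (cases s; cases z) (auto simp: less_Suc_eq eval_nat_numeral)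
    then have "\<exists>c<4. P c" by (elim disjE) (auto intro: exI[of _ 0] exI[of _ 1] exI[of _ 2] exI[of _ 3])
    then obtain c x where c: "c < 4" "y = trans_out s c @ x"
      "x = [] \<or> hd x \<in> first_letters (jones_run s (trans_out s c))"
      unfolding P_def by blast
    then have "length x < length y" using trans_out_nonempty[of c s] by simp
    moreover have "x \<in> lists {..<3}" using "1.prems"(1) c(2) by simp
    ultimately obtain w where "w \<in> lists {..<4}" "trans_word (jones_run s (trans_out s c)) w = x"
      using "1.IH" c(3) by blast
    then show ?thesis using c by (intro bexI[of _ "c # w"]) auto
  qed (intro bexI[of _ "[]"]; simp)
qed

section \<open>States and digit sums modulo 3\<close>

primrec state_class :: "jones_state \<Rightarrow> nat" where
  "state_class Eta00 = 0"
| "state_class Eta11 = 1"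
| "state_class Eta01 = 2"
| "state_class Eta10 = 2"

lemma state_class_step:
  "c < 4 \<Longrightarrow> state_class (jones_run s (trans_out s c)) = (state_class s + c) mod 3"
  by (erule less_4_cases; cases s; simp)

lemma state_class_trans_state:
  "w \<in> lists {..<4} \<Longrightarrow> state_class (trans_state s w) mod 3 = (state_class s + sum_list w) mod 3"
proof (induction w arbitrary: s)
  case (Cons c w)
  then show ?case by (simp add: state_class_step mod_simps add.assoc)
qed simp

text \<open>For states of the same class this is the identity or the shift between the first letters
  0, 1 of \<open>Eta01\<close> and 1, 2 of \<open>Eta10\<close>. The subtraction does not truncate
  on permitted letters, as those of \<open>Eta10\<close> are at least 1.\<close>

definition letter_shift :: "jones_state \<Rightarrow> jones_state \<Rightarrow> nat \<Rightarrow> nat" where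
  "letter_shift s s' c = c + (if s' = Eta10 then 1 else 0) - (if s = Eta10 then 1 else 0)"

text \<open>The letters 0, 1 from \<open>Eta01\<close> and 1, 2 from \<open>Eta10\<close> lead to
  the same states \<open>Eta01\<close>, \<open>Eta10\<close> in this order, so the ambiguity of the
  class disappears after one letter.\<close>

lemma letter_shift_step:
  "state_class s = state_class s' \<Longrightarrow> c \<in> first_letters s \<Longrightarrow>
    jones_step s c = jones_step s' (letter_shift s s' c) \<and> letter_shift s s' c < 3"
  by (cases s; cases s'; auto simp: letter_shift_def)

text \<open>The rows of \<open>trans_out\<close> for \<open>Eta01\<close> and \<open>Eta10\<close>
  differ only by 1 in the first letter of each output.\<close>

lemma transduce_shift:
  assumes "state_class s = state_class s'" "\<tau> \<in> cantor 4" "transduce s \<tau> = c ## \<rho>"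
  shows "transduce s' \<tau> = letter_shift s s' c ## \<rho>"
proof -
  obtain a \<tau>' where "\<tau> = a ## \<tau>'" "a < 4" "\<tau>' \<in> cantor 4"
    using assms(2) by (rule cantor_buildE)
  then show ?thesis using assms(1,3)
    by (elim less_4_cases; cases s; cases s') (auto simp: transduce_build letter_shift_def)
qed

section \<open>Conjugation by the transducer\<close>

text \<open>Strict monotonicity for a total order gives injectivity; no first letter is excluded in
  the start state, so the range is everything.\<close>

lemma bij_transduce: "bij_betw (transduce Eta00) (cantor 4) (cantor 3)"
proof -
  have range: "transduce_range Eta00 = cantor 3"
    by (auto simp: transduce_range_def cantor_eq first_letters_def simp del: first_letters_simps)
  have "inj_on (transduce Eta00) (cantor 4)"
  proof (rule inj_onI)
    fix \<alpha> \<beta> assume *: "\<alpha> \<in> cantor 4" "\<beta> \<in> cantor 4" "transduce Eta00 \<alpha> = transduce Eta00 \<beta>"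
    then show "\<alpha> = \<beta>"
      using wless_linear[of \<alpha> \<beta>] transduce_increasing[of Eta00] unfolding word_increasing_def
      by (metis wless_irrefl)
  qed
  moreover have "transduce Eta00 ` cantor 4 = cantor 3"
    using transduce_in_range[of _ Eta00] transduce_surj[of _ Eta00] unfolding range by blast
  ultimately show ?thesis by (simp add: bij_betw_def)
qed

section \<open>Conjugation of bijections in general\<close>

definition conj_map ::
  "'a set \<Rightarrow> ('a \<Rightarrow> 'b) \<Rightarrow> ('b \<Rightarrow> 'b) \<Rightarrow> 'a \<Rightarrow> 'a" where
  "conj_map S k f = (\<lambda>x\<in>S. inv_into S k (f (k x)))"

text \<open>Used because inverting \<open>inv_into S k\<close> gives back \<open>k\<close> only on
  \<open>S\<close>.\<close>

lemma conj_map_cong: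
  assumes "\<And>x. x \<in> S \<Longrightarrow> k x = k' x"
  shows "conj_map S k f = conj_map S k' f"
proof -
  have "inv_into S k = inv_into S k'"
    unfolding inv_into_def using assms by (intro ext arg_cong[of _ _ Eps]) auto
  then show ?thesis using assms by (auto simp: conj_map_def)
qed

lemma conj_map_Bij:
  assumes k: "bij_betw k S T" and f: "f \<in> Bij T"
  shows "conj_map S k f \<in> Bij S"
proof -
  have "bij_betw (inv_into S k \<circ> f \<circ> k) S S"
    using k f bij_betw_inv_into[OF k] unfolding Bij_def by (auto intro: bij_betw_trans)
  then have "bij_betw (conj_map S k f) S S"
    by (subst bij_betw_cong[of S _ "inv_into S k \<circ> f \<circ> k"]) (auto simp: conj_map_def)
  then show ?thesis by (auto simp: Bij_def conj_map_def)
qed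

lemma conj_map_increasing:
  assumes k: "bij_betw k S T" "word_increasing S k" and f: "f \<in> Bij T" "word_increasing T f"
  shows "word_increasing S (conj_map S k f)"
proof -
  have "word_increasing T (inv_into S k)" using k by (rule word_increasing_inv)
  moreover have "k \<alpha> \<in> T" if "\<alpha> \<in> S" for \<alpha> using k(1) that by (auto simp: bij_betw_def)
  ultimately show ?thesis
    using k(2) f Bij_imp_funcset[OF f(1)] unfolding conj_map_def word_increasing_restrict
    by (simp add: word_increasing_def Pi_iff)
qed

lemma conj_map_compose:
  assumes k: "bij_betw k S T" and f: "f \<in> Bij T" "g \<in> Bij T"
  shows "conj_map S k (compose T g f) = compose S (conj_map S k g) (conj_map S k f)"
proof
  fix x
  show "conj_map S k (compose T g f) x = compose S (conj_map S k g) (conj_map S k f) x"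
  proof (cases "x \<in> S")
    case True
    then have "k x \<in> T" using k by (auto simp: bij_betw_def)
    then have "f (k x) \<in> T" using Bij_imp_funcset[OF f(1)] by blast
    then have "inv_into S k (f (k x)) \<in> S" "k (inv_into S k (f (k x))) = f (k x)"
      using k by (auto simp: bij_betw_def inv_into_into f_inv_into_f)
    then show ?thesis using True \<open>k x \<in> T\<close> by (simp add: conj_map_def compose_def)
  qed (simp add: conj_map_def compose_def)
qed

lemma conj_map_inverse:
  assumes k: "bij_betw k S T" and f: "f \<in> Bij T"
  shows "conj_map T (inv_into S k) (conj_map S k f) = f"
proof
  fix y
  show "conj_map T (inv_into S k) (conj_map S k f) y = f y"
  proof (cases "y \<in> T")
    case True
    have "inv_into S k y \<in> S" "k (inv_into S k y) = y"
      using True k by (auto simp: bij_betw_def inv_into_into f_inv_into_f)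
    moreover have "f y \<in> T" using Bij_imp_funcset[OF f] True by blast
    ultimately show ?thesis
      using True bij_betw_inv_into_left[OF bij_betw_inv_into[OF k]] by (simp add: conj_map_def)
  next
    case False
    then show ?thesis using f by (simp add: conj_map_def Bij_def extensional_def)
  qed
qed

section \<open>Transport between the two groups\<close>

lemma conj_map_jones:
  assumes "f \<in> jones_F3"
  shows "conj_map (cantor 4) (transduce Eta00) f \<in> F_carrier 4"
proof -
  let ?k = "transduce Eta00" and ?g = "conj_map (cantor 4) (transduce Eta00) f"
  have f: "f \<in> Bij (cantor 3)" "word_increasing (cantor 3) f" "locally_branching jones_read 3 f"
    using assms by (auto simp: jones_F3_eq label_F_def)
  have k_range: "?k \<omega> \<in> cantor 3" if "\<omega> \<in> cantor 4" for \<omega>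
    using bij_transduce that by (auto simp: bij_betw_def)
  have "locally_branching (\<lambda>_. ()) 4 ?g"
    unfolding locally_branching_def
  proof
    fix \<omega> assume \<omega>: "\<omega> \<in> cantor 4"
    from f(3) k_range[OF \<omega>] obtain u v \<tau>
      where uv: "\<tau> \<in> cantor 3" "?k \<omega> = u \<frown> \<tau>" "branch jones_read 3 f u v"
      by (rule locally_branchingE)
    \<comment> \<open>Reading \<open>length u\<close> input letters yields an output at least that
      long, so \<open>u\<close> is a prefix of \<open>trans_word Eta00 w\<close> and the branch can
      be refined until its domain word is that output.\<close>
    define w where "w = \<omega> [0 \<rightarrow> length u]"
    define \<tau>' where "\<tau>' = Omega_Words_Fun.suffix (length u) \<omega>"
    have w: "w \<in> lists {..<4}" "\<tau>' \<in> cantor 4" "\<omega> = w \<frown> \<tau>'"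
      using subsequence_in_lists[OF \<omega>] suffix_in_cantor[OF \<omega>] by (simp_all add: w_def \<tau>'_def)
    have "u \<frown> \<tau> = trans_word Eta00 w \<frown> transduce (trans_state Eta00 w) \<tau>'"
      using w uv(2) by (simp add: transduce_conc)
    then have "Sublist.prefix u (trans_word Eta00 w) \<or> Sublist.prefix (trans_word Eta00 w) u"
      by (rule conc_eq_imp_prefix)
    moreover have "length u \<le> length (trans_word Eta00 w)"
      using length_trans_word[OF w(1), of Eta00] by (simp add: w_def)
    ultimately have "Sublist.prefix u (trans_word Eta00 w)"
      by (metis prefix_length_prefix prefix_order.order_refl)
    then obtain x where x: "trans_word Eta00 w = u @ x" by (auto simp: prefix_def)
    then have "x \<in> lists {..<3}" using trans_word_lists[OF w(1), of Eta00] by simp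
    with uv(3) have br: "branch jones_read 3 f (u @ x) (v @ x)"
      by (rule branch_append[OF right_congruent_jones_read])
    then have "v @ x \<in> lists {..<3}" by (simp add: branch_def)
    moreover have "v @ x = [] \<or> hd (v @ x) \<in> first_letters Eta00"
      using \<open>v @ x \<in> lists {..<3}\<close> by (cases "v @ x") auto
    ultimately obtain w' where w': "w' \<in> lists {..<4}" "trans_word Eta00 w' = v @ x"
      using trans_word_surj by metis
    \<comment> \<open>The transducer state is the Jones state of the output, so the label condition
      on the branch says exactly that the tails are transduced from the same state.\<close>
    have state: "trans_state Eta00 w = trans_state Eta00 w'"
      using br unfolding x w'(2) by (simp add: branch_def jones_read_def)
    have "branch (\<lambda>_. ()) 4 ?g w w'"
      unfolding branch_def
    proof (intro conjI ballI)
      fix \<sigma> assume \<sigma>: "\<sigma> \<in> cantor 4"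
      have "transduce (trans_state Eta00 w) \<sigma> \<in> cantor 3"
        using transduce_in_range[OF \<sigma>] by (simp add: transduce_range_def)
      then have "f (?k (w \<frown> \<sigma>)) = (v @ x) \<frown> transduce (trans_state Eta00 w) \<sigma>"
        using br \<sigma> w(1) by (simp add: transduce_conc x branch_def)
      also have "\<dots> = ?k (w' \<frown> \<sigma>)" using \<sigma> w' by (simp add: transduce_conc state)
      finally show "?g (w \<frown> \<sigma>) = w' \<frown> \<sigma>"
        using \<sigma> w(1) w'(1) bij_betw_inv_into_left[OF bij_transduce, of "w' \<frown> \<sigma>"]
        by (simp add: conj_map_def)
    qed (use w w' in simp_all)
    then show "\<exists>u v \<tau>. \<tau> \<in> cantor 4 \<and> \<omega> = u \<frown> \<tau> \<and> branch (\<lambda>_. ()) 4 ?g u v"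
      using w by blast
  qed
  then show ?thesis
    using conj_map_Bij[OF bij_transduce f(1)] conj_map_increasing[OF bij_transduce transduce_increasing f(1,2)]
    by (simp add: F_carrier_eq label_F_def)
qed

lemma conj_map_F4:
  assumes "g \<in> F_carrier 4"
  shows "conj_map (cantor 3) (inv_into (cantor 4) (transduce Eta00)) g \<in> jones_F3"
proof -
  let ?k = "transduce Eta00" and ?i = "inv_into (cantor 4) (transduce Eta00)"
  let ?f = "conj_map (cantor 3) ?i g"
  have bij_i: "bij_betw ?i (cantor 3) (cantor 4)" using bij_transduce by (rule bij_betw_inv_into)
  have g: "g \<in> Bij (cantor 4)" "word_increasing (cantor 4) g"
    "locally_branching (\<lambda>u. sum_list u mod 3) 4 g"
    using assms F_carrier_eq_digit_sum[of 3] by (auto simp: label_F_def)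
  have f_k: "?f (?k \<omega>) = ?k (g \<omega>)" if "\<omega> \<in> cantor 4" for \<omega>
  proof -
    have "?k \<omega> \<in> cantor 3" "g \<omega> \<in> cantor 4"
      using bij_transduce that Bij_in_cantor[OF g(1)] by (auto simp: bij_betw_def)
    then show ?thesis
      using that bij_betw_inv_into_left[OF bij_transduce]
      by (simp add: conj_map_def inv_into_inv_into_eq[OF bij_transduce])
  qed
  have "locally_branching jones_read 3 ?f"
    unfolding locally_branching_def
  proof
    fix \<sigma> assume \<sigma>: "\<sigma> \<in> cantor 3"
    have i_\<sigma>: "?i \<sigma> \<in> cantor 4" using bij_i \<sigma> by (auto simp: bij_betw_def)
    from g(3) this obtain w w' \<tau>
      where w: "\<tau> \<in> cantor 4" "?i \<sigma> = w \<frown> \<tau>" "branch (\<lambda>u. sum_list u mod 3) 4 g w w'"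
      by (rule locally_branchingE)
    have lists: "w \<in> lists {..<4}" "w' \<in> lists {..<4}" "sum_list w mod 3 = sum_list w' mod 3"
      using w(3) by (auto simp: branch_def)
    define s s' where "s = trans_state Eta00 w" and "s' = trans_state Eta00 w'"
    have "state_class s mod 3 = state_class s' mod 3"
      using state_class_trans_state[OF lists(1), of Eta00] state_class_trans_state[OF lists(2), of Eta00]
        lists(3) by (simp add: s_def s'_def)
    then have cls: "state_class s = state_class s'" by (cases s; cases s') auto
    \<comment> \<open>The states \<open>s\<close> and \<open>s'\<close> may be \<open>Eta01\<close>
      and \<open>Eta10\<close>. Including one more output letter in the branch, shifted on the range
      side, makes the Jones states equal.\<close>
    obtain c \<rho> where c: "transduce s \<tau> = c ## \<rho>" by (metis build_first)
    have "c \<in> first_letters s" "c < 3" "\<rho> \<in> cantor 3"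
      using transduce_in_range[OF w(1), of s] unfolding c by (simp_all add: transduce_range_def)
    note step = letter_shift_step[OF cls \<open>c \<in> first_letters s\<close>]
    let ?u = "trans_word Eta00 w @ [c]" and ?v = "trans_word Eta00 w' @ [letter_shift s s' c]"
    have "\<sigma> = ?k (w \<frown> \<tau>)" using bij_betw_inv_into_right[OF bij_transduce \<sigma>] w(2) by simp
    also have "\<dots> = ?u \<frown> \<rho>" using w(1) lists(1) c by (simp add: transduce_conc flip: s_def)
    finally have "\<sigma> = ?u \<frown> \<rho>" .
    moreover have "branch jones_read 3 ?f ?u ?v"
      unfolding branch_def
    proof (intro conjI ballI)
      show "?u \<in> lists {..<3}" "?v \<in> lists {..<3}"
        using trans_word_lists[OF lists(1), of Eta00] trans_word_lists[OF lists(2), of Eta00]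
          \<open>c < 3\<close> step by simp_all
      show "jones_read ?u = jones_read ?v"
        using step by (simp add: jones_read_def flip: s_def s'_def)
      fix \<rho>' assume "\<rho>' \<in> cantor 3"
      \<comment> \<open>The branch must hold for every tail \<open>\<rho>'\<close>, not only
        \<open>\<rho>\<close>. As \<open>c\<close> is permitted in \<open>s\<close>, each
        \<open>c ## \<rho>'\<close> comes from some input tail, on which \<open>g\<close> replaces
        \<open>w\<close> by \<open>w'\<close>.\<close>
      then have "c ## \<rho>' \<in> transduce_range s"
        using \<open>c \<in> first_letters s\<close> \<open>c < 3\<close> by (simp add: transduce_range_def)
      then obtain \<tau>' where \<tau>': "\<tau>' \<in> cantor 4" "transduce s \<tau>' = c ## \<rho>'" by (rule transduce_surj)
      then have shifted: "transduce s' \<tau>' = letter_shift s s' c ## \<rho>'" by (rule transduce_shift[OF cls])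
      have "?u \<frown> \<rho>' = ?k (w \<frown> \<tau>')"
        using \<tau>' lists(1) by (simp add: transduce_conc flip: s_def)
      then have "?f (?u \<frown> \<rho>') = ?k (g (w \<frown> \<tau>'))" using f_k[of "w \<frown> \<tau>'"] \<tau>' lists(1) by simp
      also have "\<dots> = ?k (w' \<frown> \<tau>')" using w(3) \<tau>'(1) by (simp add: branch_def)
      also have "\<dots> = ?v \<frown> \<rho>'" using \<tau>' lists(2) shifted by (simp add: transduce_conc flip: s'_def)
      finally show "?f (?u \<frown> \<rho>') = ?v \<frown> \<rho>'" .
    qed
    ultimately show "\<exists>u v \<tau>. \<tau> \<in> cantor 3 \<and> \<sigma> = u \<frown> \<tau> \<and> branch jones_read 3 ?f u v"
      using \<open>\<rho> \<in> cantor 3\<close> by blast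
  qed
  then show ?thesis
    using conj_map_Bij[OF bij_i g(1)]
      conj_map_increasing[OF bij_i word_increasing_inv[OF bij_transduce transduce_increasing] g(1,2)]
    by (simp add: jones_F3_eq label_F_def)
qed

lemma conj_map_iso:
  "conj_map (cantor 4) (transduce Eta00) \<in> iso ((F_group 3)\<lparr>carrier := jones_F3\<rparr>) (F_group 4)"
proof -
  let ?\<Psi> = "conj_map (cantor 4) (transduce Eta00)"
  let ?\<Phi> = "conj_map (cantor 3) (inv_into (cantor 4) (transduce Eta00))"
  have Bij3: "f \<in> Bij (cantor 3)" if "f \<in> jones_F3" for f
    using that by (simp add: jones_F3_eq label_F_def)
  have Bij4: "g \<in> Bij (cantor 4)" if "g \<in> F_carrier 4" for g
    using that by (simp add: F_carrier_def)
  have left: "?\<Phi> (?\<Psi> f) = f" if "f \<in> jones_F3" for f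
    using bij_transduce Bij3[OF that] by (rule conj_map_inverse)
  have right: "?\<Psi> (?\<Phi> g) = g" if "g \<in> F_carrier 4" for g
  proof -
    have "conj_map (cantor 4) (inv_into (cantor 3) (inv_into (cantor 4) (transduce Eta00))) (?\<Phi> g) = g"
      using bij_betw_inv_into[OF bij_transduce] Bij4[OF that] by (rule conj_map_inverse)
    moreover have "conj_map (cantor 4) (inv_into (cantor 3) (inv_into (cantor 4) (transduce Eta00))) (?\<Phi> g)
        = ?\<Psi> (?\<Phi> g)"
      by (rule conj_map_cong) (simp add: inv_into_inv_into_eq[OF bij_transduce])
    ultimately show ?thesis by simp
  qed
  have "bij_betw ?\<Psi> jones_F3 (F_carrier 4)"
    using conj_map_jones conj_map_F4 left right by (intro bij_betwI[where g = ?\<Phi>]) auto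
  moreover have "?\<Psi> (f \<otimes>\<^bsub>F_group 3\<^esub> h) = ?\<Psi> f \<otimes>\<^bsub>F_group 4\<^esub> ?\<Psi> h"
    if "f \<in> jones_F3" "h \<in> jones_F3" for f h
    using that conj_map_compose[OF bij_transduce Bij3[OF that(2)] Bij3[OF that(1)]]
      Bij3 Bij4[OF conj_map_jones]
    by (simp add: F_group_def BijGroup_def)
  ultimately show ?thesis
    using conj_map_jones by (auto simp: iso_def hom_def F_group_def)
qed

theorem theorem1p3:
  shows "subgroup jones_F3 (F_group 3) \<and>
         (F_group 3)\<lparr>carrier := jones_F3\<rparr> \<cong> F_group 4"
proof
  interpret B: group "BijGroup (cantor 3)" by (rule group_BijGroup)
  have "subgroup jones_F3 (BijGroup (cantor 3))" "subgroup (F_carrier 3) (BijGroup (cantor 3))"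
    using subgroup_label_F[OF right_congruent_jones_read] subgroup_label_F[OF right_congruent_const]
    by (simp_all add: jones_F3_eq F_carrier_eq)
  moreover have "jones_F3 \<subseteq> F_carrier 3" by (auto simp: jones_F3_def)
  ultimately show "subgroup jones_F3 (F_group 3)"
    unfolding F_group_def by (rule B.subgroup_incl)
  show "(F_group 3)\<lparr>carrier := jones_F3\<rparr> \<cong> F_group 4"
    using conj_map_iso by (auto simp: is_iso_def)
qed

end
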